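(* Let $g$ be the smooth complete steady gradient Ricci soliton metric on $\mathbb{R}^{d_1+1}\times M_2\times\cdots\times M_r$ associated with an admissible trajectory (as defined in the context). Then $g$ has nonnegative Ricci curvature.
   Context: Let $r\ge1$, let $d_1>1$ be an integer, $M_1=S^{d_1}$ with the round metric $h_1$ of curvature $1$, and let $(M_i,h_i)$, $i=2,\dots,r$, be compact Einstein manifolds with positive scalar curvature. Write $d_i=\dim M_i$ and $\mathrm{Ric}(h_i)=\lambda_ih_i$ with $\lambda_i>0$, so $\lambda_1=d_1-1$. Consider the system of ODEs for functions $X_1,\dots,X_r,Y_1,\dots,Y_r$ of $s$ (prime denotes $d/ds$): $$X_i'=X_i\Big(\sum_{j=1}^r X_j^2-1\Big)+\frac{Y_i^2}{\sqrt{d_i}},\qquad Y_i'=Y_i\Big(\sum_{j=1}^r X_j^2-\frac{X_i}{\sqrt{d_i}}\Big),\qquad i=1,\dots,r.$$ Put $\mathscr{L}=\sum_{i=1}^r(X_i^2+Y_i^2)-1$, $\beta=1/\sqrt{d_1}$, $\hat\beta=+\sqrt{1-\beta^2}$. An admissible trajectory is a solution defined for all $s\in\mathbb{R}$, converging as $s\to-\infty$ to the critical point $X_1=\beta$, $Y_1=\hat\beta$, $X_i=Y_i=0$ $(i>1)$, with $Y_i>0$ for all $i$ and $\mathscr{L}<0$ for all $s$. Given an admissible trajectory and a fixed constant $C<0$, the associated metric and potential are defined by $dt=\sqrt{\mathscr{L}/C}\,ds$ with $t\to0$ as $s\to-\infty$, $g_i=\sqrt{\mathscr{L}/C}\,\sqrt{d_i\lambda_i}/Y_i$,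 $g=dt^2+\sum_{i=1}^r g_i(t)^2h_i$ on $(0,\infty)\times M_1\times\cdots\times M_r$, and $u=u(t)$ obtained by integrating $\frac{du}{dt}=\sum_{i=1}^r d_i\frac{1}{g_i}\frac{dg_i}{dt}-\sqrt{C/\mathscr{L}}$. The pair $(g,u)$ extends smoothly to $\mathbb{R}^{d_1+1}\times M_2\times\cdots\times M_r$ (where $(0,\infty)\times S^{d_1}$ is identified with $\mathbb{R}^{d_1+1}\setminus\{0\}$) as a complete steady gradient Ricci soliton, i.e. $\mathrm{Ric}(g)+\mathrm{Hess}(u)=0$. *)

theory Defs
  imports "HOL-Analysis.Analysis"
begin

section \<open>Calculus on open subsets of coordinate space\<close>

text \<open>
  Dimensions vary with the index of a factor, so \<open>\<real>\<^sup>n\<close> is not modelled by a type but by the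
  library topology \<open>powertop_real I\<close> for a finite index set \<open>I\<close>, whose points are the extensional
  functions \<open>I \<rightarrow>\<^sub>E UNIV\<close>.
\<close>

definition pd :: "'k \<Rightarrow> (('k \<Rightarrow> real) \<Rightarrow> real) \<Rightarrow> ('k \<Rightarrow> real) \<Rightarrow> real" where
  "pd k f x = deriv (\<lambda>\<tau>. f (x(k := \<tau>))) (x k)"

fun Ck_on :: "nat \<Rightarrow> 'k set \<Rightarrow> ('k \<Rightarrow> real) set \<Rightarrow> (('k \<Rightarrow> real) \<Rightarrow> real) \<Rightarrow> bool" where
  "Ck_on 0 I W f \<longleftrightarrow> continuous_map (subtopology (powertop_real I) W) euclideanreal f"
| "Ck_on (Suc n) I W f \<longleftrightarrow>
     continuous_map (subtopology (powertop_real I) W) euclideanreal f \<and>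
     (\<forall>k\<in>I. (\<forall>x\<in>W. (\<lambda>\<tau>. f (x(k := \<tau>))) differentiable (at (x k))) \<and> Ck_on n I W (pd k f))"

text \<open>Only meaningful when \<open>W\<close> is open in \<open>powertop_real I\<close>.\<close>

definition smooth_on :: "'k set \<Rightarrow> ('k \<Rightarrow> real) set \<Rightarrow> (('k \<Rightarrow> real) \<Rightarrow> real) \<Rightarrow> bool" where
  "smooth_on I W f \<longleftrightarrow> (\<forall>n. Ck_on n I W f)"


section \<open>Curvature of a metric in local coordinates\<close>

text \<open>A left inverse of the \<open>I \<times> I\<close> matrix \<open>A\<close>; its entries in \<open>I \<times> I\<close> are unique if \<open>A\<close> is
  invertible.\<close>

definition inv_mat :: "'k set \<Rightarrow> ('k \<Rightarrow> 'k \<Rightarrow> real) \<Rightarrow> 'k \<Rightarrow> 'k \<Rightarrow> real" where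
  "inv_mat I A = (SOME B. \<forall>k\<in>I. \<forall>m\<in>I. (\<Sum>l\<in>I. B k l * A l m) = (if k = m then 1 else 0))"

text \<open>\<open>christoffel I G x m k l\<close> is \<open>\<Gamma>\<^sup>m\<^sub>k\<^sub>l\<close> of the metric with components \<open>G x k l\<close>.\<close>

definition christoffel ::
  "'k set \<Rightarrow> (('k \<Rightarrow> real) \<Rightarrow> 'k \<Rightarrow> 'k \<Rightarrow> real) \<Rightarrow> ('k \<Rightarrow> real) \<Rightarrow> 'k \<Rightarrow> 'k \<Rightarrow> 'k \<Rightarrow> real" where
  "christoffel I G x m k l =
     (1/2) * (\<Sum>n\<in>I. inv_mat I (G x) m n *
        (pd k (\<lambda>y. G y n l) x + pd l (\<lambda>y. G y n k) x - pd n (\<lambda>y. G y k l) x))"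

text \<open>\<open>riemann I G x m k i l\<close> is \<open>R\<^sup>m\<^sub>k\<^sub>i\<^sub>l\<close>, the \<open>m\<close>-component of
  \<open>R(\<partial>\<^sub>i, \<partial>\<^sub>l)\<partial>\<^sub>k = \<nabla>\<^sub>i\<nabla>\<^sub>l\<partial>\<^sub>k - \<nabla>\<^sub>l\<nabla>\<^sub>i\<partial>\<^sub>k\<close>; with this sign round spheres have positive Ricci
  curvature.\<close>

definition riemann ::
  "'k set \<Rightarrow> (('k \<Rightarrow> real) \<Rightarrow> 'k \<Rightarrow> 'k \<Rightarrow> real) \<Rightarrow> ('k \<Rightarrow> real) \<Rightarrow> 'k \<Rightarrow> 'k \<Rightarrow> 'k \<Rightarrow> 'k \<Rightarrow> real" where
  "riemann I G x m k i l =
     pd i (\<lambda>y. christoffel I G y m l k) x - pd l (\<lambda>y. christoffel I G y m i k) x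
     + (\<Sum>j\<in>I. christoffel I G x m i j * christoffel I G x j l k)
     - (\<Sum>j\<in>I. christoffel I G x m l j * christoffel I G x j i k)"

definition ricci_loc ::
  "'k set \<Rightarrow> (('k \<Rightarrow> real) \<Rightarrow> 'k \<Rightarrow> 'k \<Rightarrow> real) \<Rightarrow> ('k \<Rightarrow> real) \<Rightarrow> 'k \<Rightarrow> 'k \<Rightarrow> real" where
  "ricci_loc I G x k l = (\<Sum>m\<in>I. riemann I G x m k m l)"

definition hess_loc ::
  "'k set \<Rightarrow> (('k \<Rightarrow> real) \<Rightarrow> 'k \<Rightarrow> 'k \<Rightarrow> real) \<Rightarrow> (('k \<Rightarrow> real) \<Rightarrow> real) \<Rightarrow> ('k \<Rightarrow> real) \<Rightarrow> 'k \<Rightarrow> 'k \<Rightarrow> real" where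
  "hess_loc I G f x k l = pd k (pd l f) x - (\<Sum>m\<in>I. christoffel I G x m k l * pd m f x)"


section \<open>Smooth manifolds and Riemannian metrics\<close>

type_synonym ('p, 'k) chart = "'p set \<times> ('p \<Rightarrow> 'k \<Rightarrow> real)"

record ('p, 'k) mfd =
  mtop :: "'p topology"
  coords :: "'k set"
  atlas :: "('p, 'k) chart set"

text \<open>The dimension is \<open>card (coords M)\<close>. The atlas need not be maximal.\<close>

definition smooth_manifold :: "('p, 'k) mfd \<Rightarrow> bool" where
  "smooth_manifold M \<longleftrightarrow>
     finite (coords M) \<and> Hausdorff_space (mtop M) \<and> second_countable (mtop M) \<and>
     (\<Union>(U, \<phi>)\<in>atlas M. U) = topspace (mtop M) \<and>
     (\<forall>(U, \<phi>)\<in>atlas M. openin (mtop M) U \<and> openin (powertop_real (coords M)) (\<phi> ` U) \<and>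
        homeomorphic_map (subtopology (mtop M) U) (subtopology (powertop_real (coords M)) (\<phi> ` U)) \<phi>) \<and>
     (\<forall>(U, \<phi>)\<in>atlas M. \<forall>(V, \<psi>)\<in>atlas M. \<forall>k\<in>coords M.
        smooth_on (coords M) (\<phi> ` (U \<inter> V)) (\<lambda>x. \<psi> (inv_into U \<phi> x) k))"

definition smooth_fun :: "('p, 'k) mfd \<Rightarrow> ('p \<Rightarrow> real) \<Rightarrow> bool" where
  "smooth_fun M f \<longleftrightarrow> (\<forall>(U, \<phi>)\<in>atlas M. smooth_on (coords M) (\<phi> ` U) (\<lambda>x. f (inv_into U \<phi> x)))"

text \<open>A covariant 2-tensor is given by its components \<open>T c p k l\<close> in every chart \<open>c\<close> of the
  atlas at every point \<open>p\<close> of the chart domain.\<close>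

type_synonym ('p, 'k) tensor2 = "('p, 'k) chart \<Rightarrow> 'p \<Rightarrow> 'k \<Rightarrow> 'k \<Rightarrow> real"

definition loc :: "('p, 'k) tensor2 \<Rightarrow> ('p, 'k) chart \<Rightarrow> ('k \<Rightarrow> real) \<Rightarrow> 'k \<Rightarrow> 'k \<Rightarrow> real" where
  "loc T c x = T c (inv_into (fst c) (snd c) x)"

definition smooth_tensor2 :: "('p, 'k) mfd \<Rightarrow> ('p, 'k) tensor2 \<Rightarrow> bool" where
  "smooth_tensor2 M T \<longleftrightarrow>
     (\<forall>(U, \<phi>)\<in>atlas M. \<forall>k\<in>coords M. \<forall>l\<in>coords M.
        smooth_on (coords M) (\<phi> ` U) (\<lambda>x. loc T (U, \<phi>) x k l)) \<and>
     (\<forall>(U, \<phi>)\<in>atlas M. \<forall>(V, \<psi>)\<in>atlas M. \<forall>p\<in>U \<inter> V. \<forall>k\<in>coords M. \<forall>l\<in>coords M.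
        T (U, \<phi>) p k l =
        (\<Sum>a\<in>coords M. \<Sum>b\<in>coords M.
           pd k (\<lambda>x. \<psi> (inv_into U \<phi> x) a) (\<phi> p) * pd l (\<lambda>x. \<psi> (inv_into U \<phi> x) b) (\<phi> p)
           * T (V, \<psi>) p a b))"

definition riemannian_metric :: "('p, 'k) mfd \<Rightarrow> ('p, 'k) tensor2 \<Rightarrow> bool" where
  "riemannian_metric M g \<longleftrightarrow>
     smooth_tensor2 M g \<and>
     (\<forall>c\<in>atlas M. \<forall>p\<in>fst c.
        (\<forall>k\<in>coords M. \<forall>l\<in>coords M. g c p k l = g c p l k) \<and>
        (\<forall>v. (\<exists>k\<in>coords M. v k \<noteq> 0) \<longrightarrow>
           0 < (\<Sum>k\<in>coords M. \<Sum>l\<in>coords M. g c p k l * v k * v l)))"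

definition Ric :: "('p, 'k) mfd \<Rightarrow> ('p, 'k) tensor2 \<Rightarrow> ('p, 'k) tensor2" where
  "Ric M g c p = ricci_loc (coords M) (loc g c) (snd c p)"

definition Hess :: "('p, 'k) mfd \<Rightarrow> ('p, 'k) tensor2 \<Rightarrow> ('p \<Rightarrow> real) \<Rightarrow> ('p, 'k) tensor2" where
  "Hess M g f c p =
     hess_loc (coords M) (loc g c) (\<lambda>x. f (inv_into (fst c) (snd c) x)) (snd c p)"

definition nonneg_Ricci :: "('p, 'k) mfd \<Rightarrow> ('p, 'k) tensor2 \<Rightarrow> bool" where
  "nonneg_Ricci M g \<longleftrightarrow>
     (\<forall>c\<in>atlas M. \<forall>p\<in>fst c. \<forall>v.
        0 \<le> (\<Sum>k\<in>coords M. \<Sum>l\<in>coords M. Ric M g c p k l * v k * v l))"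

definition einstein :: "('p, 'k) mfd \<Rightarrow> ('p, 'k) tensor2 \<Rightarrow> real \<Rightarrow> bool" where
  "einstein M g lam \<longleftrightarrow>
     (\<forall>c\<in>atlas M. \<forall>p\<in>fst c. \<forall>k\<in>coords M. \<forall>l\<in>coords M. Ric M g c p k l = lam * g c p k l)"

definition geodesic :: "('p, 'k) mfd \<Rightarrow> ('p, 'k) tensor2 \<Rightarrow> (real \<Rightarrow> 'p) \<Rightarrow> bool" where
  "geodesic M g \<gamma> \<longleftrightarrow>
     continuous_map euclideanreal (mtop M) \<gamma> \<and>
     (\<forall>(U, \<phi>)\<in>atlas M. \<forall>\<tau>. \<gamma> \<tau> \<in> U \<longrightarrow> (\<forall>m\<in>coords M.
        (\<lambda>\<sigma>. \<phi> (\<gamma> \<sigma>) m) differentiable (at \<tau>) \<and>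
        (deriv (\<lambda>\<sigma>. \<phi> (\<gamma> \<sigma>) m) has_real_derivative
           - (\<Sum>k\<in>coords M. \<Sum>l\<in>coords M. christoffel (coords M) (loc g (U, \<phi>)) (\<phi> (\<gamma> \<tau>)) m k l
                * deriv (\<lambda>\<sigma>. \<phi> (\<gamma> \<sigma>) k) \<tau> * deriv (\<lambda>\<sigma>. \<phi> (\<gamma> \<sigma>) l) \<tau>)) (at \<tau>)))"

text \<open>Completeness as geodesic completeness: every tangent vector is the initial velocity of a
  geodesic defined on all of \<open>\<real>\<close>.\<close>

definition complete_riemannian :: "('p, 'k) mfd \<Rightarrow> ('p, 'k) tensor2 \<Rightarrow> bool" where
  "complete_riemannian M g \<longleftrightarrow>
     (\<forall>(U, \<phi>)\<in>atlas M. \<forall>p\<in>U. \<forall>v. \<exists>\<gamma>. geodesic M g \<gamma> \<and> \<gamma> 0 = p \<and>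
        (\<forall>m\<in>coords M. ((\<lambda>\<sigma>. \<phi> (\<gamma> \<sigma>) m) has_real_derivative v m) (at 0)))"

definition complete_steady_gradient_soliton ::
  "('p, 'k) mfd \<Rightarrow> ('p, 'k) tensor2 \<Rightarrow> ('p \<Rightarrow> real) \<Rightarrow> bool" where
  "complete_steady_gradient_soliton M g u \<longleftrightarrow>
     riemannian_metric M g \<and> complete_riemannian M g \<and> smooth_fun M u \<and>
     (\<forall>c\<in>atlas M. \<forall>p\<in>fst c. \<forall>k\<in>coords M. \<forall>l\<in>coords M.
        Ric M g c p k l + Hess M g u c p k l = 0)"


section \<open>Euclidean space and products\<close>

definition euclid :: "nat \<Rightarrow> (nat \<Rightarrow> real, nat) mfd" where
  "euclid n = \<lparr> mtop = powertop_real {..<n}, coords = {..<n},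
                atlas = {({..<n} \<rightarrow>\<^sub>E UNIV, \<lambda>x. x)} \<rparr>"

definition pair_chart ::
  "'k set \<Rightarrow> 'l set \<Rightarrow> ('p, 'k) chart \<Rightarrow> ('q, 'l) chart \<Rightarrow> ('p \<times> 'q, 'k + 'l) chart" where
  "pair_chart I J c e =
     (fst c \<times> fst e,
      \<lambda>(p, q). restrict (\<lambda>j. case j of Inl k \<Rightarrow> snd c p k | Inr l \<Rightarrow> snd e q l) (I <+> J))"

definition prod_mfd :: "('p, 'k) mfd \<Rightarrow> ('q, 'l) mfd \<Rightarrow> ('p \<times> 'q, 'k + 'l) mfd" where
  "prod_mfd M N =
     \<lparr> mtop = prod_topology (mtop M) (mtop N), coords = coords M <+> coords N,
       atlas = {pair_chart (coords M) (coords N) c e | c e. c \<in> atlas M \<and> e \<in> atlas N} \<rparr>"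

definition fam_chart ::
  "nat set \<Rightarrow> (nat \<Rightarrow> 'k set) \<Rightarrow> (nat \<Rightarrow> ('p, 'k) chart) \<Rightarrow> (nat \<Rightarrow> 'p, nat \<times> 'k) chart" where
  "fam_chart J I c =
     (Pi\<^sub>E J (\<lambda>i. fst (c i)), \<lambda>m. restrict (\<lambda>(i, k). snd (c i) (m i) k) (Sigma J I))"

definition fam_prod_mfd :: "nat set \<Rightarrow> (nat \<Rightarrow> ('p, 'k) mfd) \<Rightarrow> (nat \<Rightarrow> 'p, nat \<times> 'k) mfd" where
  "fam_prod_mfd J M =
     \<lparr> mtop = product_topology (\<lambda>i. mtop (M i)) J, coords = Sigma J (\<lambda>i. coords (M i)),
       atlas = {fam_chart J (\<lambda>i. coords (M i)) c | c. \<forall>i\<in>J. c i \<in> atlas (M i)} \<rparr>"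

text \<open>\<open>\<real>^(d\<^sub>1 + 1) \<times> M\<^sub>2 \<times> \<dots> \<times> M\<^sub>r\<close>. The entries \<open>M 0\<close> and \<open>M 1\<close> of the
  family are not used: \<open>M\<^sub>1\<close> is the unit sphere of the first factor.\<close>

definition total_space ::
  "nat \<Rightarrow> (nat \<Rightarrow> nat) \<Rightarrow> (nat \<Rightarrow> ('a, nat) mfd) \<Rightarrow> ((nat \<Rightarrow> real) \<times> (nat \<Rightarrow> 'a), nat + nat \<times> nat) mfd" where
  "total_space r d M = prod_mfd (euclid (d 1 + 1)) (fam_prod_mfd {2..r} M)"

definition total_chart ::
  "nat \<Rightarrow> (nat \<Rightarrow> nat) \<Rightarrow> (nat \<Rightarrow> ('a, nat) mfd) \<Rightarrow> (nat \<Rightarrow> ('a, nat) chart) \<Rightarrow>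
     ((nat \<Rightarrow> real) \<times> (nat \<Rightarrow> 'a), nat + nat \<times> nat) chart" where
  "total_chart r d M c =
     pair_chart {..<d 1 + 1} (Sigma {2..r} (\<lambda>i. coords (M i)))
       ({..<d 1 + 1} \<rightarrow>\<^sub>E UNIV, \<lambda>x. x) (fam_chart {2..r} (\<lambda>i. coords (M i)) c)"


section \<open>The dynamical system and the associated soliton\<close>

definition ode_system ::
  "nat \<Rightarrow> (nat \<Rightarrow> nat) \<Rightarrow> (nat \<Rightarrow> real \<Rightarrow> real) \<Rightarrow> (nat \<Rightarrow> real \<Rightarrow> real) \<Rightarrow> bool" where
  "ode_system r d X Y \<longleftrightarrow>
     (\<forall>i\<in>{1..r}. \<forall>s.
        (X i has_real_derivative
           X i s * ((\<Sum>j=1..r. (X j s)\<^sup>2) - 1) + (Y i s)\<^sup>2 / sqrt (real (d i))) (at s) \<and>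
        (Y i has_real_derivative
           Y i s * ((\<Sum>j=1..r. (X j s)\<^sup>2) - X i s / sqrt (real (d i)))) (at s))"

definition lyap :: "nat \<Rightarrow> (nat \<Rightarrow> real \<Rightarrow> real) \<Rightarrow> (nat \<Rightarrow> real \<Rightarrow> real) \<Rightarrow> real \<Rightarrow> real" where
  "lyap r X Y s = (\<Sum>i=1..r. (X i s)\<^sup>2 + (Y i s)\<^sup>2) - 1"

definition admissible_trajectory ::
  "nat \<Rightarrow> (nat \<Rightarrow> nat) \<Rightarrow> (nat \<Rightarrow> real \<Rightarrow> real) \<Rightarrow> (nat \<Rightarrow> real \<Rightarrow> real) \<Rightarrow> bool" where
  "admissible_trajectory r d X Y \<longleftrightarrow>
     ode_system r d X Y \<and>
     (let \<beta> = 1 / sqrt (real (d 1)) in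
        (X 1 \<longlongrightarrow> \<beta>) at_bot \<and> (Y 1 \<longlongrightarrow> sqrt (1 - \<beta>\<^sup>2)) at_bot) \<and>
     (\<forall>i\<in>{2..r}. (X i \<longlongrightarrow> 0) at_bot \<and> (Y i \<longlongrightarrow> 0) at_bot) \<and>
     (\<forall>i\<in>{1..r}. \<forall>s. 0 < Y i s) \<and>
     (\<forall>s. lyap r X Y s < 0)"

text \<open>\<open>t\<close> is a function of \<open>s\<close>; the warping functions \<open>w i\<close> (called \<open>g\<^sub>i\<close> informally) and the
  potential \<open>u\<close> are functions of \<open>t\<close>, relevant only on \<open>t > 0\<close>.\<close>

definition assoc_profile ::
  "nat \<Rightarrow> (nat \<Rightarrow> nat) \<Rightarrow> (nat \<Rightarrow> real) \<Rightarrow> (nat \<Rightarrow> real \<Rightarrow> real) \<Rightarrow> (nat \<Rightarrow> real \<Rightarrow> real) \<Rightarrow> real \<Rightarrow>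
     (real \<Rightarrow> real) \<Rightarrow> (nat \<Rightarrow> real \<Rightarrow> real) \<Rightarrow> (real \<Rightarrow> real) \<Rightarrow> bool" where
  "assoc_profile r d lam X Y C t w u \<longleftrightarrow>
     (\<forall>s. (t has_real_derivative sqrt (lyap r X Y s / C)) (at s)) \<and> (t \<longlongrightarrow> 0) at_bot \<and>
     (\<forall>i\<in>{1..r}. \<forall>s.
        w i (t s) = sqrt (lyap r X Y s / C) * (sqrt (real (d i) * lam i) / Y i s)) \<and>
     (\<forall>s. (u has_real_derivative
             (\<Sum>i=1..r. real (d i) * (1 / w i (t s)) * deriv (w i) (t s)) - sqrt (C / lyap r X Y s))
          (at (t s)))"

definition rad :: "nat \<Rightarrow> (nat \<Rightarrow> real) \<Rightarrow> real" where
  "rad n x = sqrt (\<Sum>k<n. (x k)\<^sup>2)"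

text \<open>The round metric of the unit sphere is the restriction of the Euclidean metric. Hence its
  pullback along \<open>x \<mapsto> x / |x|\<close> to \<open>\<real>\<^sup>n \<setminus> {0}\<close> is the pullback of the Euclidean metric
  along this map.\<close>

definition round_pullback :: "nat \<Rightarrow> (nat \<Rightarrow> real) \<Rightarrow> nat \<Rightarrow> nat \<Rightarrow> real" where
  "round_pullback n x k l =
     (\<Sum>m<n. pd k (\<lambda>y. y m / rad n y) x * pd l (\<lambda>y. y m / rad n y) x)"

text \<open>Components in the chart \<open>total_chart r d M c\<close> of \<open>dt\<^sup>2 + \<Sum>\<^sub>i w\<^sub>i(t)\<^sup>2 h\<^sub>i\<close>, where
  \<open>x \<noteq> 0\<close> is identified with \<open>(t, \<theta>) = (|x|, x / |x|)\<close>.\<close>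

definition warped_metric ::
  "(nat \<Rightarrow> nat) \<Rightarrow> (nat \<Rightarrow> real \<Rightarrow> real) \<Rightarrow> (nat \<Rightarrow> ('a, nat) tensor2) \<Rightarrow> (nat \<Rightarrow> ('a, nat) chart) \<Rightarrow>
     (nat \<Rightarrow> real) \<times> (nat \<Rightarrow> 'a) \<Rightarrow> nat + nat \<times> nat \<Rightarrow> nat + nat \<times> nat \<Rightarrow> real" where
  "warped_metric d w h c = (\<lambda>(x, m) a b.
     let n = d 1 + 1; t = rad n x in
     (case (a, b) of
        (Inl k, Inl l) \<Rightarrow> pd k (rad n) x * pd l (rad n) x + (w 1 t)\<^sup>2 * round_pullback n x k l
      | (Inr (i, k), Inr (j, l)) \<Rightarrow> (if i = j then (w i t)\<^sup>2 * h i (c i) (m i) k l else 0)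
      | _ \<Rightarrow> 0))"

text \<open>\<open>g\<close> and \<open>f\<close>, given on the total space, restrict to the warped metric and to \<open>u(t)\<close> on the
  complement of \<open>{0} \<times> M\<^sub>2 \<times> \<dots> \<times> M\<^sub>r\<close>.\<close>

definition extends_warped ::
  "nat \<Rightarrow> (nat \<Rightarrow> nat) \<Rightarrow> (nat \<Rightarrow> ('a, nat) mfd) \<Rightarrow> (nat \<Rightarrow> ('a, nat) tensor2) \<Rightarrow>
     (nat \<Rightarrow> real \<Rightarrow> real) \<Rightarrow> (real \<Rightarrow> real) \<Rightarrow>
     ((nat \<Rightarrow> real) \<times> (nat \<Rightarrow> 'a), nat + nat \<times> nat) tensor2 \<Rightarrow>
     ((nat \<Rightarrow> real) \<times> (nat \<Rightarrow> 'a) \<Rightarrow> real) \<Rightarrow> bool" where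
  "extends_warped r d M h w u g f \<longleftrightarrow>
     (\<forall>c. (\<forall>i\<in>{2..r}. c i \<in> atlas (M i)) \<longrightarrow>
        (\<forall>(x, m)\<in>fst (total_chart r d M c). 0 < rad (d 1 + 1) x \<longrightarrow>
           f (x, m) = u (rad (d 1 + 1) x) \<and>
           (\<forall>a\<in>coords (total_space r d M). \<forall>b\<in>coords (total_space r d M).
              g (total_chart r d M c) (x, m) a b = warped_metric d w h c (x, m) a b)))"

end

theory Submission
  imports Defs
begin

text \<open>
  By the soliton equation \<open>Ric = - Hess u\<close>, so it suffices that \<open>Hess u \<le> 0\<close>. Off the core
  \<open>{0} \<times> M\<^sub>2 \<times> \<dots> \<times> M\<^sub>r\<close>, contracting the Christoffel symbols with the radial field gives
  \<open>Hess u = u'' dt\<^sup>2 + u' \<Sum>\<^sub>i g\<^sub>i g\<^sub>i' h\<^sub>i\<close>. With \<open>H = \<Sum>\<^sub>i \<surd>d\<^sub>i X\<^sub>i\<close> and \<open>\<sigma> = dt/ds\<close> one has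
  \<open>g\<^sub>i' = g\<^sub>i X\<^sub>i / (\<surd>d\<^sub>i \<sigma>)\<close>, \<open>u' = (H - 1) / \<sigma>\<close> and \<open>u'' = (L - (H - 1)) / \<sigma>\<^sup>2\<close>, where \<open>L\<close> is the
  Lyapunov function, so the signs follow from \<open>X\<^sub>i \<ge> 0\<close> and \<open>L \<le> H - 1 \<le> 0\<close>. Each of these is
  a quantity with nonnegative limit at \<open>s = -\<infinity>\<close> that does not decrease where it is negative,
  since \<open>\<Sum>\<^sub>i X\<^sub>i\<^sup>2 < 1\<close>. On the core \<open>u\<close> is a critical even function of the Cartesian
  coordinates, so its Hessian is diagonal in them with nonpositive entries.
\<close>

section \<open>The trajectory\<close>

text \<open>If \<open>f s\<close> were negative, let \<open>b\<close> be the last point before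
  \<open>s\<close> where \<open>f\<close> is at least half of \<open>f s\<close>. Between
  \<open>b\<close> and \<open>s\<close> the function is negative, hence nondecreasing, so
  \<open>f b \<le> f s\<close>, which contradicts the choice of \<open>b\<close>.\<close>

lemma nonneg_if_limit_at_bot_nonneg:
  fixes f f' :: "real \<Rightarrow> real"
  assumes der: "\<And>s. (f has_real_derivative f' s) (at s)"
    and neg: "\<And>s. f s < 0 \<Longrightarrow> 0 \<le> f' s"
    and lim: "(f \<longlongrightarrow> l) at_bot" and l: "0 \<le> l"
  shows "0 \<le> f s"
proof (rule ccontr)
  assume "\<not> 0 \<le> f s"
  \<comment> \<open>A level strictly between \<open>f s\<close> and 0, which \<open>f\<close>
    exceeds near minus infinity even when \<open>l = 0\<close>.\<close>
  define c where "c = f s / 2"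
  have c: "f s < c" "c < 0" using \<open>\<not> 0 \<le> f s\<close> by (auto simp: c_def)
  have "\<forall>\<^sub>F x in at_bot. c < f x" by (rule order_tendstoD(1)[OF lim]) (use l c in simp)
  then obtain N where N: "\<And>x. x \<le> N \<Longrightarrow> c < f x" by (auto simp: eventually_at_bot_linorder)
  \<comment> \<open>The minimum with \<open>s - 1\<close> puts \<open>a\<close> to the left of
    \<open>s\<close>, so that \<open>a\<close> witnesses that the compact set \<open>K\<close> is
    nonempty.\<close>
  define a where "a = min N (s - 1)"
  have cont: "continuous_on S f" for S
    using der by (meson DERIV_isCont continuous_at_imp_continuous_on)
  define K where "K = {a..s} \<inter> f -` {c..}"
  have "closed K" unfolding K_def by (intro continuous_closed_preimage cont) auto
  moreover have "bounded K" unfolding K_def by (rule bounded_subset[OF bounded_closed_interval[of a s]]) auto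
  ultimately have "compact K" by (simp add: compact_eq_bounded_closed)
  moreover have "a \<in> K" using N[of a] by (auto simp: K_def a_def)
  ultimately obtain b where b: "b \<in> K" "\<And>x. x \<in> K \<Longrightarrow> x \<le> b"
    using compact_attains_sup[of K] by blast
  have "b < s" using b c by (force simp: K_def)
  have "f b \<le> f s"
  proof (rule DERIV_nonneg_imp_increasing_open[of b s f])
    show "b \<le> s" using \<open>b < s\<close> by simp
    show "continuous_on {b..s} f" by (rule cont)
  next
    fix x assume "b < x" "x < s"
    then have "x \<notin> K" using b(2)[of x] by auto
    then have "f x < c" using \<open>b < x\<close> \<open>x < s\<close> b(1) by (auto simp: K_def)
    then show "\<exists>y. (f has_real_derivative y) (at x) \<and> 0 \<le> y" using der neg c by fastforce
  qed
  then show False using b(1) c by (auto simp: K_def)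
qed

locale soliton_profile =
  fixes r :: nat and d :: "nat \<Rightarrow> nat" and lam :: "nat \<Rightarrow> real"
    and X Y :: "nat \<Rightarrow> real \<Rightarrow> real" and C :: real
    and t :: "real \<Rightarrow> real" and w :: "nat \<Rightarrow> real \<Rightarrow> real" and u :: "real \<Rightarrow> real"
  assumes r: "1 \<le> r" and d1: "1 < d 1"
    and d: "\<And>i. i \<in> {1..r} \<Longrightarrow> 1 \<le> d i" and lam: "\<And>i. i \<in> {1..r} \<Longrightarrow> 0 < lam i"
    and adm: "admissible_trajectory r d X Y" and C: "C < 0"
    and prof: "assoc_profile r d lam X Y C t w u"
begin

definition "L = lyap r X Y"
definition "S s = (\<Sum>j=1..r. (X j s)\<^sup>2)"
definition "H s = (\<Sum>i=1..r. sqrt (real (d i)) * X i s)"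
definition "\<sigma> s = sqrt (L s / C)"

section \<open>Evolution equations in the variable \<open>s\<close>\<close>

lemma derX: "i \<in> {1..r} \<Longrightarrow> (X i has_real_derivative X i s * (S s - 1) + (Y i s)\<^sup>2 / sqrt (real (d i))) (at s)"
  and derY: "i \<in> {1..r} \<Longrightarrow> (Y i has_real_derivative Y i s * (S s - X i s / sqrt (real (d i)))) (at s)"
  using adm by (auto simp: admissible_trajectory_def ode_system_def S_def)

lemma Ypos: "i \<in> {1..r} \<Longrightarrow> 0 < Y i s" and Lneg: "L s < 0"
  using adm by (auto simp: admissible_trajectory_def L_def)

lemma L_eq: "L s = S s + (\<Sum>i=1..r. (Y i s)\<^sup>2) - 1"
  by (simp add: L_def lyap_def S_def sum.distrib)

text \<open>The cubic terms \<open>X i * (Y i)\<^sup>2 / sqrt (d i)\<close> from the two families of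
  equations cancel, and \<open>2 * S\<close> factors out of what remains.\<close>

lemma derL: "(L has_real_derivative 2 * S s * L s) (at s)"
proof -
  have "((\<lambda>s. S s + (\<Sum>i=1..r. (Y i s)\<^sup>2) - 1) has_real_derivative
     (\<Sum>i=1..r. 2 * (X i s * (X i s * (S s - 1) + (Y i s)\<^sup>2 / sqrt (real (d i)))))
     + (\<Sum>i=1..r. 2 * (Y i s * (Y i s * (S s - X i s / sqrt (real (d i))))))) (at s)"
    unfolding S_def
    by (auto intro!: derivative_eq_intros derX[unfolded S_def] derY[unfolded S_def]
        arg_cong2[where f="(+)"] sum.cong)
  also have "(\<Sum>i=1..r. 2 * (X i s * (X i s * (S s - 1) + (Y i s)\<^sup>2 / sqrt (real (d i)))))
     + (\<Sum>i=1..r. 2 * (Y i s * (Y i s * (S s - X i s / sqrt (real (d i))))))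
     = (\<Sum>i=1..r. 2 * (S s - 1) * (X i s)\<^sup>2 + 2 * S s * (Y i s)\<^sup>2)"
    unfolding sum.distrib[symmetric] by (intro sum.cong) (auto simp: algebra_simps power2_eq_square)
  also have "\<dots> = 2 * (S s - 1) * S s + 2 * S s * (\<Sum>i=1..r. (Y i s)\<^sup>2)"
    by (simp add: sum.distrib sum_distrib_left[symmetric] S_def)
  also have "\<dots> = 2 * S s * L s" by (simp add: L_eq algebra_simps)
  finally show ?thesis unfolding L_eq[abs_def] by simp
qed

lemma S_nonneg: "0 \<le> S s" by (simp add: S_def sum_nonneg)

text \<open>A consequence of the negativity of \<open>L\<close>; it makes \<open>S - 1\<close> a
  damping factor in all the sign arguments below.\<close>

lemma S_less: "S s < 1"
proof -
  have "0 \<le> (\<Sum>i=1..r. (Y i s)\<^sup>2)" by (simp add: sum_nonneg)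
  then show ?thesis using Lneg[of s] L_eq[of s] by linarith
qed

lemma \<sigma>_pos: "0 < \<sigma> s" using Lneg C by (simp add: \<sigma>_def divide_neg_neg)

lemma \<sigma>_sq: "(\<sigma> s)\<^sup>2 = L s / C" using Lneg[of s] C by (simp add: \<sigma>_def divide_nonpos_neg)

lemma der\<sigma>: "(\<sigma> has_real_derivative S s * \<sigma> s) (at s)"
proof -
  have p: "0 < L s / C" using Lneg[of s] C by (simp add: divide_neg_neg)
  have "(\<sigma> has_real_derivative (2 * S s * L s / C) * (inverse (sqrt (L s / C)) / 2)) (at s)"
    unfolding \<sigma>_def[abs_def] using p C
    by (auto intro!: derivative_eq_intros derL simp: field_simps)
  also have "(2 * S s * L s / C) * (inverse (sqrt (L s / C)) / 2) = S s * ((\<sigma> s)\<^sup>2 * inverse (\<sigma> s))"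
    unfolding \<sigma>_sq by (simp add: \<sigma>_def)
  also have "\<dots> = S s * \<sigma> s" using \<sigma>_pos[of s] by (simp add: power2_eq_square)
  finally show ?thesis .
qed

text \<open>The weights \<open>sqrt (d i)\<close> cancel the denominators in the equations for
  \<open>X i\<close>. The result is centred at \<open>H - 1\<close>, the numerator of u'.\<close>

lemma derH: "(H has_real_derivative (H s - 1) * (S s - 1) + L s) (at s)"
proof -
  have "(H has_real_derivative
     (\<Sum>i=1..r. sqrt (real (d i)) * (X i s * (S s - 1) + (Y i s)\<^sup>2 / sqrt (real (d i))))) (at s)"
    unfolding H_def[abs_def] by (auto intro!: derivative_eq_intros derX sum.cong)
  also have "(\<Sum>i=1..r. sqrt (real (d i)) * (X i s * (S s - 1) + (Y i s)\<^sup>2 / sqrt (real (d i))))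
     = (\<Sum>i=1..r. (S s - 1) * (sqrt (real (d i)) * X i s) + (Y i s)\<^sup>2)"
    using d by (intro sum.cong) (force simp: field_simps)+
  also have "\<dots> = (S s - 1) * H s + (\<Sum>i=1..r. (Y i s)\<^sup>2)"
    by (simp add: sum.distrib sum_distrib_left[symmetric] H_def)
  also have "\<dots> = (H s - 1) * (S s - 1) + L s" by (simp add: L_eq algebra_simps)
  finally show ?thesis .
qed

section \<open>Limits at minus infinity and sign conditions\<close>

lemma limX: "i \<in> {1..r} \<Longrightarrow> (X i \<longlongrightarrow> (if i = 1 then 1 / sqrt (real (d 1)) else 0)) at_bot"
  and limY: "i \<in> {1..r} \<Longrightarrow> (Y i \<longlongrightarrow> (if i = 1 then sqrt (1 - (1 / sqrt (real (d 1)))\<^sup>2) else 0)) at_bot"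
  using adm by (cases "i = 1"; auto simp: admissible_trajectory_def Let_def)+

lemma limH: "(H \<longlongrightarrow> 1) at_bot"
proof -
  have "(H \<longlongrightarrow> (\<Sum>i=1..r. sqrt (real (d i)) * (if i = 1 then 1 / sqrt (real (d 1)) else 0))) at_bot"
    unfolding H_def[abs_def] by (intro tendsto_sum tendsto_mult tendsto_const limX)
  also have "(\<Sum>i=1..r. sqrt (real (d i)) * (if i = 1 then 1 / sqrt (real (d 1)) else 0))
      = (\<Sum>i=1..r. if i = 1 then 1 else 0)"
    using d1 by (intro sum.cong) auto
  finally show ?thesis using r by simp
qed

text \<open>The limiting critical point lies on the unit sphere, since the squares of its two
  nonzero coordinates add up to 1.\<close>

lemma limL: "(L \<longlongrightarrow> 0) at_bot"
proof -
  have *: "0 \<le> 1 - (1 / sqrt (real (d 1)))\<^sup>2" using d1 by (simp add: power_divide)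
  have "(L \<longlongrightarrow> (\<Sum>i=1..r. (if i = 1 then 1 / sqrt (real (d 1)) else 0)\<^sup>2
      + (if i = 1 then sqrt (1 - (1 / sqrt (real (d 1)))\<^sup>2) else 0)\<^sup>2) - 1) at_bot"
    unfolding L_def lyap_def[abs_def] by (intro tendsto_intros limX limY)
  also have "(\<Sum>i=1..r. (if i = 1 then 1 / sqrt (real (d 1)) else 0)\<^sup>2
      + (if i = 1 then sqrt (1 - (1 / sqrt (real (d 1)))\<^sup>2) else 0)\<^sup>2)
      = (\<Sum>i=1..r. if i = 1 then 1 else 0)"
    using * by (intro sum.cong) auto
  finally show ?thesis using r by simp
qed

lemma X_nonneg: assumes i: "i \<in> {1..r}" shows "0 \<le> X i s"
proof (rule nonneg_if_limit_at_bot_nonneg[OF derX[OF i] _ limX[OF i]])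
  fix s assume "X i s < 0"
  then have "0 \<le> X i s * (S s - 1)" using S_less[of s] by (simp add: mult_nonpos_nonpos)
  then show "0 \<le> X i s * (S s - 1) + (Y i s)\<^sup>2 / sqrt (real (d i))" by simp
qed auto

text \<open>Where \<open>H\<close> exceeds 1, both terms of its derivative are negative because
  \<open>S < 1\<close> and \<open>L < 0\<close>.\<close>

lemma H_le: "H s \<le> 1"
proof -
  have "0 \<le> 1 - H s"
  proof (rule nonneg_if_limit_at_bot_nonneg[where f="\<lambda>s. 1 - H s"])
    show "((\<lambda>s. 1 - H s) has_real_derivative - ((H s - 1) * (S s - 1) + L s)) (at s)" for s
      by (auto intro!: derivative_eq_intros derH)
    show "((\<lambda>s. 1 - H s) \<longlongrightarrow> 0) at_bot" using tendsto_diff[OF tendsto_const limH, of 1] by simp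
    show "0 \<le> - ((H s - 1) * (S s - 1) + L s)" if "1 - H s < 0" for s
      using that S_less[of s] Lneg[of s] mult_nonneg_nonpos[of "H s - 1" "S s - 1"] by simp
  qed simp
  then show ?thesis by simp
qed

text \<open>The derivative of \<open>H - 1 - L\<close> rearranges to
  \<open>(H - 1 - L) * (S - 1) - S * L\<close>, whose terms are both nonnegative where the
  difference is negative. This inequality yields concavity of \<open>u\<close>.\<close>

lemma L_le: "L s \<le> H s - 1"
proof -
  have "0 \<le> H s - 1 - L s"
  proof (rule nonneg_if_limit_at_bot_nonneg[where f="\<lambda>s. H s - 1 - L s"])
    show "((\<lambda>s. H s - 1 - L s) has_real_derivative (H s - 1) * (S s - 1) + L s - 2 * S s * L s) (at s)" for s
      by (auto intro!: derivative_eq_intros derH derL)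
    show "((\<lambda>s. H s - 1 - L s) \<longlongrightarrow> 0) at_bot"
      using tendsto_diff[OF tendsto_diff[OF limH tendsto_const] limL, of 1] by simp
    show "0 \<le> (H s - 1) * (S s - 1) + L s - 2 * S s * L s" if "H s - 1 - L s < 0" for s
    proof -
      have "(H s - 1) * (S s - 1) + L s - 2 * S s * L s = (H s - 1 - L s) * (S s - 1) + S s * (- L s)"
        by (simp add: algebra_simps)
      moreover have "0 \<le> (H s - 1 - L s) * (S s - 1)"
        using that S_less[of s] by (simp add: mult_nonpos_nonpos)
      moreover have "0 \<le> S s * (- L s)"
        using S_nonneg Lneg[of s] by (intro mult_nonneg_nonneg) auto
      ultimately show ?thesis by linarith
    qed
  qed simp
  then show ?thesis by simp
qed

section \<open>Passage from \<open>s\<close> to the arc length \<open>t\<close>\<close>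

lemma dert: "(t has_real_derivative \<sigma> s) (at s)"
  and limt: "(t \<longlongrightarrow> 0) at_bot"
  and w_t: "i \<in> {1..r} \<Longrightarrow> w i (t s) = \<sigma> s * (sqrt (real (d i) * lam i) / Y i s)"
  and deru: "(u has_real_derivative
       (\<Sum>i=1..r. real (d i) * (1 / w i (t s)) * deriv (w i) (t s)) - sqrt (C / L s)) (at (t s))"
  using prof unfolding assoc_profile_def \<sigma>_def L_def by blast+

lemma t_strict_mono: "strict_mono t"
  by (rule strict_monoI) (meson DERIV_pos_imp_increasing dert \<sigma>_pos)

text \<open>Positivity comes from the limit 0 and strict monotonicity. For surjectivity,
  \<open>S \<ge> 0\<close> makes \<open>\<sigma>\<close> nondecreasing, so \<open>t\<close> grows at
  least linearly for \<open>s \<ge> 0\<close>.\<close>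

lemma range_t: "range t = {0<..}"
proof -
  have pos: "0 < t s" for s
  proof -
    have "0 \<le> t (s - 1)"
    proof (rule tendsto_upperbound[OF limt])
      show "\<forall>\<^sub>F x in at_bot. t x \<le> t (s - 1)"
        using eventually_le_at_bot[of "s - 1"] by eventually_elim (simp add: strict_mono_less_eq[OF t_strict_mono])
    qed simp
    also have "\<dots> < t s" using t_strict_mono by (simp add: strict_monoD)
    finally show ?thesis .
  qed
  have mono\<sigma>: "\<sigma> 0 \<le> \<sigma> s" if "0 \<le> s" for s :: real
    by (rule DERIV_nonneg_imp_nondecreasing[OF that]) (meson der\<sigma> S_nonneg \<sigma>_pos less_imp_le mult_nonneg_nonneg)
  have grow: "t 0 + \<sigma> 0 * s \<le> t s" if "0 \<le> s" for s :: real
  proof -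
    have "(\<lambda>s. t s - \<sigma> 0 * s) 0 \<le> (\<lambda>s. t s - \<sigma> 0 * s) s"
    proof (rule DERIV_nonneg_imp_nondecreasing[OF that])
      fix x :: real assume "0 \<le> x"
      then have "0 \<le> \<sigma> x - \<sigma> 0" using mono\<sigma> by simp
      moreover have "((\<lambda>s. t s - \<sigma> 0 * s) has_real_derivative \<sigma> x - \<sigma> 0) (at x)"
        by (auto intro!: derivative_eq_intros dert)
      ultimately show "\<exists>y. ((\<lambda>s. t s - \<sigma> 0 * s) has_real_derivative y) (at x) \<and> 0 \<le> y" by blast
    qed
    then show ?thesis by simp
  qed
  have "\<rho> \<in> range t" if "0 < \<rho>" for \<rho>
  proof -
    have "\<forall>\<^sub>F x in at_bot. t x < \<rho>" using limt that by (rule order_tendstoD)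
    then obtain a where a: "t a < \<rho>" by (auto simp: eventually_at_bot_linorder)
    \<comment> \<open>The linear lower bound gives \<open>t b \<ge> t 0 + \<rho>\<close>, which
      already exceeds \<open>\<rho>\<close>.\<close>
    define b where "b = \<rho> / \<sigma> 0"
    have "\<rho> \<le> t b" using grow[of b] pos[of 0] \<sigma>_pos[of 0] that by (auto simp: b_def)
    moreover have "a \<le> b" using a \<open>\<rho> \<le> t b\<close> strict_mono_less[OF t_strict_mono, of a b] by linarith
    ultimately obtain x where "t x = \<rho>"
      using IVT'[of t a \<rho> b] a dert by (meson DERIV_isCont continuous_at_imp_continuous_on less_imp_le)
    then show ?thesis by blast
  qed
  then show ?thesis using pos by auto
qed

text \<open>Chain rule through the inverse of \<open>t\<close>. The function \<open>\<psi>\<close>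
  is known only on the range of \<open>t\<close>, but this range is open and so determines
  \<open>\<psi>\<close> near \<open>t s\<close>.\<close>

lemma der_via_t:
  assumes der: "(\<phi> has_real_derivative y) (at s)" and eq: "\<And>s. \<psi> (t s) = \<phi> s"
  shows "(\<psi> has_real_derivative y / \<sigma> s) (at (t s))"
proof -
  define T where "T = inv t"
  have inj: "inj t" using t_strict_mono by (simp add: strict_mono_imp_inj_on)
  have Tt: "T (t s) = s" for s by (simp add: T_def inj)
  have tT: "t (T y) = y" if "0 < y" for y
    using that range_t by (auto simp: T_def f_inv_into_f)
  have pos: "0 < t s" using range_t by auto
  have cont: "isCont T (t s)"
    by (rule isCont_inverse_function[where d=1 and f=t]) (auto simp: Tt intro: DERIV_isCont[OF dert])
  have "(T has_real_derivative inverse (\<sigma> s)) (at (t s))"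
  \<comment> \<open>The left end is 0 because \<open>T\<close> inverts \<open>t\<close> only on the
    positive reals; the right end is any number beyond \<open>t s\<close>.\<close>
  proof (rule DERIV_inverse_function[where f=t and a=0 and b="t s + 1"])
    show "(t has_real_derivative \<sigma> s) (at (T (t s)))" by (simp add: Tt dert)
  qed (use \<sigma>_pos[of s] pos tT cont in auto)
  then have "(\<phi> \<circ> T has_real_derivative y * inverse (\<sigma> s)) (at (t s))"
    using der by (intro DERIV_chain) (auto simp: Tt)
  moreover have "\<forall>\<^sub>F z in nhds (t s). (\<phi> \<circ> T) z = \<psi> z"
    using eventually_nhds_in_open[of "{0<..}" "t s"] pos
    by (auto elim!: eventually_mono simp: eq[symmetric] tT)
  ultimately show ?thesis
    by (simp add: DERIV_cong_ev[OF refl _ refl] divide_inverse)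
qed

text \<open>In the logarithmic derivative of \<open>\<sigma> / Y i\<close> the two occurrences of
  \<open>S\<close> cancel, leaving \<open>X i / sqrt (d i)\<close>; the change of variable divides
  by \<open>\<sigma>\<close>.\<close>

lemma derw:
  assumes i: "i \<in> {1..r}"
  shows "(w i has_real_derivative w i (t s) * X i s / (sqrt (real (d i)) * \<sigma> s)) (at (t s))"
proof -
  let ?c = "sqrt (real (d i) * lam i)"
  have "((\<lambda>s. \<sigma> s * (?c / Y i s)) has_real_derivative \<sigma> s * (?c / Y i s) * X i s / sqrt (real (d i))) (at s)"
    using Ypos[OF i, of s] d[OF i]
    by (auto intro!: derivative_eq_intros der\<sigma> derY[OF i] simp: field_simps)
  from der_via_t[OF this w_t[OF i]] show ?thesis by (simp add: w_t[OF i])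
qed

lemma w_pos: "i \<in> {1..r} \<Longrightarrow> 0 < w i (t s)"
  using Ypos[of i s] d[of i] lam[of i] \<sigma>_pos[of s] by (auto simp: w_t)

lemma deru': "(u has_real_derivative (H s - 1) / \<sigma> s) (at (t s))"
proof -
  have "real (d i) * (1 / w i (t s)) * deriv (w i) (t s) = sqrt (real (d i)) * X i s / \<sigma> s"
    if i: "i \<in> {1..r}" for i
  proof -
    have "real (d i) * (1 / w i (t s)) * (w i (t s) * X i s / (sqrt (real (d i)) * \<sigma> s))
        = (real (d i) / sqrt (real (d i))) * X i s / \<sigma> s"
      using w_pos[OF i, of s] by simp
    then show ?thesis unfolding DERIV_imp_deriv[OF derw[OF i]] by (simp add: real_div_sqrt)
  qed
  then have "(\<Sum>i=1..r. real (d i) * (1 / w i (t s)) * deriv (w i) (t s)) = H s / \<sigma> s"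
    by (simp add: H_def sum_divide_distrib)
  moreover have "sqrt (C / L s) = 1 / \<sigma> s"
    unfolding \<sigma>_def by (simp add: real_sqrt_divide)
  ultimately show ?thesis using deru[of s] by (simp add: diff_divide_distrib)
qed

text \<open>Everything the geometric part needs from the dynamics, stated in the radius alone so
  that \<open>s\<close> no longer occurs.\<close>

lemma radial_profile:
  "\<exists>D D' w'. \<forall>\<rho>>0.
     (u has_real_derivative D \<rho>) (at \<rho>) \<and> (D has_real_derivative D' \<rho>) (at \<rho>) \<and>
     D \<rho> \<le> 0 \<and> D' \<rho> \<le> 0 \<and>
     (\<forall>i\<in>{1..r}. (w i has_real_derivative w' i \<rho>) (at \<rho>) \<and> 0 \<le> w i \<rho> * w' i \<rho>)"
proof (rule exI[of _ "deriv u"], rule exI[of _ "deriv (deriv u)"], rule exI[of _ "\<lambda>i. deriv (w i)"],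
    intro allI impI conjI ballI)
  fix \<rho> :: real assume "0 < \<rho>"
  then obtain s where s: "\<rho> = t s" using range_t by blast
  have Du: "deriv u (t s) = (H s - 1) / \<sigma> s" for s by (rule DERIV_imp_deriv[OF deru'])
  show "(u has_real_derivative deriv u \<rho>) (at \<rho>)" using deru'[of s] by (simp add: s Du)
  show "deriv u \<rho> \<le> 0" using H_le[of s] \<sigma>_pos[of s] by (simp add: s Du divide_nonpos_pos)
  \<comment> \<open>The terms with \<open>S\<close> from \<open>H\<close> and from
    \<open>\<sigma>\<close> cancel; a second division by \<open>\<sigma>\<close> then gives
    u''.\<close>
  have "((\<lambda>s. (H s - 1) / \<sigma> s) has_real_derivative (L s - (H s - 1)) / \<sigma> s) (at s)"
    using \<sigma>_pos[of s]
    by (auto intro!: derivative_eq_intros derH der\<sigma> simp: field_simps)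
  from der_via_t[OF this Du]
  have *: "(deriv u has_real_derivative (L s - (H s - 1)) / \<sigma> s / \<sigma> s) (at \<rho>)" by (simp add: s)
  then show "(deriv u has_real_derivative deriv (deriv u) \<rho>) (at \<rho>)" by (simp add: DERIV_imp_deriv)
  show "deriv (deriv u) \<rho> \<le> 0"
    using L_le[of s] \<sigma>_pos[of s] by (simp add: DERIV_imp_deriv[OF *] divide_nonpos_pos)
  fix i assume i: "i \<in> {1..r}"
  then show "(w i has_real_derivative deriv (w i) \<rho>) (at \<rho>)"
    using derw[OF i, of s] by (simp add: s DERIV_imp_deriv)
  show "0 \<le> w i \<rho> * deriv (w i) \<rho>"
    using w_pos[OF i, of s] X_nonneg[OF i, of s] \<sigma>_pos[of s]
    by (simp add: s DERIV_imp_deriv[OF derw[OF i]])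
qed

end

section \<open>Christoffel symbols contracted with a gradient\<close>

definition mat_pd :: "'k set \<Rightarrow> ('k \<Rightarrow> 'k \<Rightarrow> real) \<Rightarrow> bool" where
  "mat_pd I A \<longleftrightarrow> (\<forall>v. (\<exists>k\<in>I. v k \<noteq> 0) \<longrightarrow> 0 < (\<Sum>k\<in>I. \<Sum>l\<in>I. A k l * v k * v l))"

text \<open>Test vectors on the smaller index set are extended by zero.\<close>

lemma mat_pd_subset:
  assumes "mat_pd I A" "J \<subseteq> I" "finite I"
  shows "mat_pd J A"
  unfolding mat_pd_def
proof (intro allI impI)
  fix v :: "'a \<Rightarrow> real" assume "\<exists>k\<in>J. v k \<noteq> 0"
  define v' where "v' k = (if k \<in> J then v k else 0)" for k
  have "\<exists>k\<in>I. v' k \<noteq> 0" using \<open>\<exists>k\<in>J. v k \<noteq> 0\<close> assms(2) by (auto simp: v'_def)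
  then have "0 < (\<Sum>k\<in>I. \<Sum>l\<in>I. A k l * v' k * v' l)" using assms(1) by (simp add: mat_pd_def)
  also have "\<dots> = (\<Sum>k\<in>J. \<Sum>l\<in>I. A k l * v' k * v' l)"
    using assms by (intro sum.mono_neutral_right) (auto simp: v'_def)
  also have "\<dots> = (\<Sum>k\<in>J. \<Sum>l\<in>J. A k l * v' k * v' l)"
    using assms by (intro sum.cong sum.mono_neutral_right) (auto simp: v'_def)
  also have "\<dots> = (\<Sum>k\<in>J. \<Sum>l\<in>J. A k l * v k * v l)"
    by (intro sum.cong) (auto simp: v'_def)
  finally show "0 < (\<Sum>k\<in>J. \<Sum>l\<in>J. A k l * v k * v l)" .
qed

text \<open>Gaussian elimination; the Schur complement \<open>s\<close> of the new index is a value of the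
  quadratic form, hence nonzero.\<close>

lemma mat_pd_solvable:
  assumes "finite I" "mat_pd I A"
  shows "\<exists>b. \<forall>m\<in>I. (\<Sum>l\<in>I. b l * A l m) = y m"
  using assms
proof (induction I arbitrary: y)
  case empty
  then show ?case by simp
next
  case (insert a I)
  have pd: "mat_pd I A" using mat_pd_subset[OF insert.prems] insert.hyps by auto
  obtain b0 where b0: "\<And>m. m \<in> I \<Longrightarrow> (\<Sum>l\<in>I. b0 l * A l m) = y m"
    using insert.IH[OF pd, of y] by blast
  obtain c where c: "\<And>m. m \<in> I \<Longrightarrow> (\<Sum>l\<in>I. c l * A l m) = A a m"
    using insert.IH[OF pd, of "A a"] by blast
  \<comment> \<open>The row vector \<open>v\<close> annihilates every column indexed by
    \<open>I\<close>, so the quadratic form at \<open>v\<close> reduces to its pairing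
    \<open>s\<close> with column \<open>a\<close>.\<close>
  define v where "v l = (if l = a then 1 else - c l)" for l
  have va: "v a = 1" by (simp add: v_def)
  define s where "s = (\<Sum>l\<in>insert a I. v l * A l a)"
  have vI: "(\<Sum>l\<in>I. v l * A l m) = - (\<Sum>l\<in>I. c l * A l m)" for m
    unfolding sum_negf[symmetric] using insert.hyps by (intro sum.cong) (auto simp: v_def)
  have v0: "(\<Sum>l\<in>insert a I. v l * A l m) = 0" if "m \<in> I" for m
    using insert.hyps c[OF that] vI[of m] by (simp add: v_def)
  have "0 < (\<Sum>k\<in>insert a I. \<Sum>l\<in>insert a I. A k l * v k * v l)"
    using insert.prems by (auto simp: mat_pd_def v_def)
  also have "\<dots> = (\<Sum>l\<in>insert a I. (\<Sum>k\<in>insert a I. v k * A k l) * v l)"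
    by (subst sum.swap) (simp add: sum_distrib_left mult_ac del: sum.insert)
  also have "\<dots> = (\<Sum>l\<in>insert a I. if l = a then s else 0)"
  proof (intro sum.cong refl)
    fix l assume "l \<in> insert a I"
    then show "(\<Sum>k\<in>insert a I. v k * A k l) * v l = (if l = a then s else 0)"
      using v0[of l] va by (cases "l = a") (simp_all add: s_def mult.commute del: sum.insert)
  qed
  also have "\<dots> = s" using insert.hyps by simp
  finally have s: "s \<noteq> 0" by simp
  \<comment> \<open>The multiple of \<open>v\<close> that corrects column \<open>a\<close>; the
    columns already solved are not disturbed.\<close>
  define \<beta> where "\<beta> = (y a - (\<Sum>l\<in>I. b0 l * A l a)) / s"
  define b where "b l = (if l = a then 0 else b0 l) + \<beta> * v l" for l
  have bsum: "(\<Sum>l\<in>insert a I. b l * A l m) = (\<Sum>l\<in>I. b0 l * A l m) + \<beta> * (\<Sum>l\<in>insert a I. v l * A l m)" for m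
  proof -
    have "(\<Sum>l\<in>insert a I. b l * A l m)
       = (\<Sum>l\<in>insert a I. (if l = a then 0 else b0 l) * A l m) + \<beta> * (\<Sum>l\<in>insert a I. v l * A l m)"
      unfolding sum_distrib_left sum.distrib[symmetric]
      by (intro sum.cong) (auto simp: b_def algebra_simps)
    also have "(\<Sum>l\<in>insert a I. (if l = a then 0 else b0 l) * A l m) = (\<Sum>l\<in>I. b0 l * A l m)"
      using insert.hyps by (auto intro!: sum.cong)
    finally show ?thesis .
  qed
  have "(\<Sum>l\<in>insert a I. b l * A l m) = y m" if "m \<in> insert a I" for m
  proof (cases "m = a")
    case True
    then show ?thesis using s bsum[of a, folded s_def] by (simp add: \<beta>_def del: sum.insert)
  next
    case False
    then show ?thesis using that bsum[of m] v0[of m] b0[of m] by (simp del: sum.insert)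
  qed
  then show ?case by blast
qed

text \<open>Solving one linear system per row shows that a left inverse exists, so the choice in
  \<open>inv_mat\<close> meets its specification.\<close>

lemma inv_mat_left:
  assumes "finite I" "mat_pd I A" "k \<in> I" "m \<in> I"
  shows "(\<Sum>l\<in>I. inv_mat I A k l * A l m) = (if k = m then 1 else 0)"
proof -
  obtain B where "\<And>k. \<forall>m\<in>I. (\<Sum>l\<in>I. B k l * A l m) = (if k = m then 1 else 0)"
    using mat_pd_solvable[OF assms(1,2), of "\<lambda>m. if _ = m then 1 else 0"] by metis
  then have "\<exists>B. \<forall>k\<in>I. \<forall>m\<in>I. (\<Sum>l\<in>I. B k l * A l m) = (if k = m then 1 else 0)" by blast
  from someI_ex[OF this] show ?thesis unfolding inv_mat_def using assms(3,4) by blast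
qed

text \<open>A left inverse \<open>B\<close> of a symmetric matrix \<open>A\<close> is symmetric because
  \<open>B = B (B A)\<^sup>T = (B A) B\<^sup>T = B\<^sup>T\<close>.\<close>

lemma inv_mat_sym:
  assumes fin: "finite I" and pd: "mat_pd I A" and sym: "\<And>k l. k \<in> I \<Longrightarrow> l \<in> I \<Longrightarrow> A k l = A l k"
    and k: "k \<in> I" and m: "m \<in> I"
  shows "inv_mat I A k m = inv_mat I A m k"
proof -
  define B where "B = inv_mat I A"
  note left = inv_mat_left[OF fin pd, folded B_def]
  have "(\<Sum>l\<in>I. \<Sum>p\<in>I. B k l * A l p * B m p) = (\<Sum>l\<in>I. B k l * (\<Sum>p\<in>I. B m p * A p l))"
    using sym by (simp add: sum_distrib_left mult_ac)
  also have "\<dots> = (\<Sum>l\<in>I. if m = l then B k l else 0)"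
    using left[OF m] by (intro sum.cong) auto
  also have "\<dots> = B k m" using fin m by simp
  finally have 1: "(\<Sum>l\<in>I. \<Sum>p\<in>I. B k l * A l p * B m p) = B k m" .
  have "(\<Sum>l\<in>I. \<Sum>p\<in>I. B k l * A l p * B m p) = (\<Sum>p\<in>I. (\<Sum>l\<in>I. B k l * A l p) * B m p)"
    by (subst sum.swap) (simp add: sum_distrib_right)
  also have "\<dots> = (\<Sum>p\<in>I. if k = p then B m p else 0)"
    using left[OF k] by (intro sum.cong) auto
  also have "\<dots> = B m k" using fin k by simp
  finally show ?thesis using 1 by (simp add: B_def)
qed

text \<open>The vector \<open>N\<close> is the metric dual of the covector \<open>p\<close>.
  Contracting with \<open>p\<close> lets the inverse matrix raise its index to \<open>N\<close>, so
  no inverse has to be computed.\<close>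

lemma christoffel_contract:
  assumes fin: "finite I" and pd: "mat_pd I (G x)"
    and sym: "\<And>k l. k \<in> I \<Longrightarrow> l \<in> I \<Longrightarrow> G x k l = G x l k"
    and grad: "\<And>l. l \<in> I \<Longrightarrow> (\<Sum>n\<in>I. G x l n * N n) = p l"
  shows "(\<Sum>m\<in>I. christoffel I G x m k l * p m) =
    (1/2) * (\<Sum>n\<in>I. N n * (pd k (\<lambda>y. G y n l) x + pd l (\<lambda>y. G y n k) x - pd n (\<lambda>y. G y k l) x))"
proof -
  define B where "B = inv_mat I (G x)"
  note left = inv_mat_left[OF fin pd, folded B_def]
  define T where "T n = pd k (\<lambda>y. G y n l) x + pd l (\<lambda>y. G y n k) x - pd n (\<lambda>y. G y k l) x" for n
  have raise: "(\<Sum>m\<in>I. B m n * p m) = N n" if n: "n \<in> I" for n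
  proof -
    have "(\<Sum>m\<in>I. B m n * p m) = (\<Sum>m\<in>I. \<Sum>j\<in>I. B n m * (G x m j * N j))"
      using inv_mat_sym[OF fin pd sym, folded B_def, OF _ _ _ n] grad
      by (simp add: sum_distrib_left[symmetric])
    also have "\<dots> = (\<Sum>j\<in>I. (\<Sum>m\<in>I. B n m * G x m j) * N j)"
      by (subst sum.swap) (simp add: sum_distrib_right mult.assoc)
    also have "\<dots> = (\<Sum>j\<in>I. if n = j then N j else 0)"
      using left[OF n] by (intro sum.cong) auto
    finally show ?thesis using fin n by simp
  qed
  have "(\<Sum>m\<in>I. christoffel I G x m k l * p m) = (\<Sum>m\<in>I. \<Sum>n\<in>I. 1/2 * (T n * (B m n * p m)))"
    by (simp add: christoffel_def B_def[symmetric] T_def[symmetric] sum_distrib_left sum_distrib_right mult_ac)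
  also have "\<dots> = (\<Sum>n\<in>I. 1/2 * (T n * (\<Sum>m\<in>I. B m n * p m)))"
    by (subst sum.swap) (simp add: sum_distrib_left)
  also have "\<dots> = 1/2 * (\<Sum>n\<in>I. N n * T n)"
    using raise by (simp add: sum_distrib_left mult.commute)
  finally show ?thesis by (simp add: T_def)
qed

section \<open>Functions of the radius\<close>

lemma pdI: "((\<lambda>\<tau>. f (x(k := \<tau>))) has_real_derivative y) (at (x k)) \<Longrightarrow> pd k f x = y"
  by (simp add: pd_def DERIV_imp_deriv)

lemma rad_sq: "(rad n x)\<^sup>2 = (\<Sum>k<n. (x k)\<^sup>2)"
  by (simp add: rad_def sum_nonneg)

lemma rad_nonneg: "0 \<le> rad n x"
  by (simp add: rad_def sum_nonneg)

lemma rad_eq_0_iff: "rad n x = 0 \<longleftrightarrow> (\<forall>k<n. x k = 0)"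
  by (auto simp: rad_def sum_nonneg_eq_0_iff)

lemma coord_upd_deriv:
  "((\<lambda>\<tau>. (x(k := \<tau>)) l) has_real_derivative (if k = l then 1 else 0)) (at a)"
  by (cases "k = l") auto

lemma rad_upd_deriv:
  assumes "k < n" "0 < rad n x"
  shows "((\<lambda>\<tau>. rad n (x(k := \<tau>))) has_real_derivative x k / rad n x) (at (x k))"
proof -
  have pos: "0 < (\<Sum>l<n. (x l)\<^sup>2)" using assms(2) by (simp add: rad_def)
  have "((\<lambda>\<tau>. \<Sum>l<n. ((x(k := \<tau>)) l)\<^sup>2) has_real_derivative
     (\<Sum>l<n. 2 * ((if k = l then 1 else 0) * x l))) (at (x k))"
    by (rule DERIV_sum, rule DERIV_cong[OF DERIV_power[OF coord_upd_deriv]]) auto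
  also have "(\<Sum>l<n. 2 * ((if k = l then 1 else 0) * x l)) = (\<Sum>l<n. if k = l then 2 * x l else 0)"
    by (intro sum.cong) auto
  finally have *: "((\<lambda>\<tau>. \<Sum>l<n. ((x(k := \<tau>)) l)\<^sup>2) has_real_derivative 2 * x k) (at (x k))"
    using assms(1) by simp
  have "((\<lambda>\<tau>. sqrt (\<Sum>l<n. ((x(k := \<tau>)) l)\<^sup>2)) has_real_derivative
      inverse (sqrt (\<Sum>l<n. (x l)\<^sup>2)) / 2 * (2 * x k)) (at (x k))"
    by (rule DERIV_chain2[OF _ *]) (use DERIV_real_sqrt[OF pos] in \<open>simp add: fun_upd_idem\<close>)
  then show ?thesis by (simp add: rad_def field_simps)
qed

lemma radial_upd_deriv:
  assumes "k < n" "0 < rad n x" "(\<phi> has_real_derivative \<phi>') (at (rad n x))"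
  shows "((\<lambda>\<tau>. \<phi> (rad n (x(k := \<tau>)))) has_real_derivative \<phi>' * (x k / rad n x)) (at (x k))"
  by (rule DERIV_chain2[OF _ rad_upd_deriv[OF assms(1,2)]]) (simp add: assms(3))

text \<open>Formulas valid only off the origin may thus be differentiated along coordinate
  lines.\<close>

lemma eventually_rad_upd_pos:
  assumes "k < n" "0 < rad n x"
  shows "\<forall>\<^sub>F \<tau> in nhds (x k). 0 < rad n (x(k := \<tau>))"
proof -
  have "((\<lambda>\<tau>. rad n (x(k := \<tau>))) \<longlongrightarrow> rad n x) (nhds (x k))"
    using DERIV_isCont[OF rad_upd_deriv[OF assms]]
      tendsto_at_iff_tendsto_nhds[of "\<lambda>\<tau>. rad n (x(k := \<tau>))" "x k"]
    by (simp add: isCont_def)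
  then show ?thesis using assms(2) by (rule order_tendstoD)
qed

lemma pd_rad: "k < n \<Longrightarrow> 0 < rad n x \<Longrightarrow> pd k (rad n) x = x k / rad n x"
  by (rule pdI[OF rad_upd_deriv])

lemma pd_unit:
  assumes "k < n" "0 < rad n x"
  shows "pd k (\<lambda>y. y m / rad n y) x = ((if k = m then 1 else 0) - x k * x m / (rad n x)\<^sup>2) / rad n x"
proof (rule pdI)
  show "((\<lambda>\<tau>. (x(k := \<tau>)) m / rad n (x(k := \<tau>))) has_real_derivative
     ((if k = m then 1 else 0) - x k * x m / (rad n x)\<^sup>2) / rad n x) (at (x k))"
    by (rule DERIV_cong[OF DERIV_divide[OF coord_upd_deriv rad_upd_deriv[OF assms]]])
      (use assms in \<open>auto simp: field_simps power2_eq_square\<close>)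
qed

lemma sum_delta_times:
  "k < n \<Longrightarrow> (\<Sum>m<n. (if k = m then 1 else 0) * F m) = (F k :: real)" for k n :: nat
  by (simp add: if_distrib[of "\<lambda>z. z * _"] cong: if_cong)

text \<open>The derivative of x/|x| is the orthogonal projection off the radial line divided by the
  radius, and this projection is symmetric and idempotent.\<close>

lemma round_pullback_eq:
  assumes "k < n" "l < n" "0 < rad n x"
  shows "round_pullback n x k l = ((if k = l then 1 else 0) - x k * x l / (rad n x)\<^sup>2) / (rad n x)\<^sup>2"
proof -
  define R where "R = rad n x"
  have R: "R > 0" using assms by (simp add: R_def)
  \<comment> \<open>With \<open>q\<close> the summands become polynomial, and the sum of the squared
    coordinates is \<open>1 / q\<close>.\<close>
  define q where "q = 1 / R\<^sup>2"
  have RR: "(\<Sum>m<n. x m * x m) = 1 / q" by (simp add: q_def R_def rad_sq flip: power2_eq_square)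
  have "round_pullback n x k l = (\<Sum>m<n. ((if k = m then 1 else 0) - x k * x m / R\<^sup>2) / R
       * (((if l = m then 1 else 0) - x l * x m / R\<^sup>2) / R))"
    unfolding round_pullback_def R_def using assms by (simp add: pd_unit)
  also have "\<dots> = (\<Sum>m<n. (if k = m then 1 else 0) * ((if l = m then 1 else 0) * q)
      - (if k = m then 1 else 0) * (x l * x m * q\<^sup>2) - (if l = m then 1 else 0) * (x k * x m * q\<^sup>2)
      + x k * x l * q ^ 3 * (x m * x m))"
  proof (intro sum.cong refl)
    have "(a / R) * (b / R) = a * b * q" for a b by (simp add: q_def power2_eq_square)
    moreover have "a / R\<^sup>2 = a * q" for a by (simp add: q_def)
    ultimately show "((if k = m then 1 else 0) - x k * x m / R\<^sup>2) / R
       * (((if l = m then 1 else 0) - x l * x m / R\<^sup>2) / R) =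
       (if k = m then 1 else 0) * ((if l = m then 1 else 0) * q)
      - (if k = m then 1 else 0) * (x l * x m * q\<^sup>2) - (if l = m then 1 else 0) * (x k * x m * q\<^sup>2)
      + x k * x l * q ^ 3 * (x m * x m)" for m
      by (simp only: algebra_simps power2_eq_square power3_eq_cube)
  qed
  also have "\<dots> = (if l = k then 1 else 0) * q - x l * x k * q\<^sup>2 - x k * x l * q\<^sup>2 + x k * x l * q ^ 3 * (1 / q)"
    using assms by (simp only: sum.distrib sum_subtractf sum_delta_times sum_distrib_left[symmetric] RR)
  also have "\<dots> = ((if k = l then 1 else 0) - x k * x l / R\<^sup>2) / R\<^sup>2"
  proof -
    have "q ^ 3 * (1 / q) = q\<^sup>2" using R by (simp add: q_def power3_eq_cube power2_eq_square)
    moreover have "a / R\<^sup>2 = a * q" for a by (simp add: q_def)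
    ultimately show ?thesis by (simp add: algebra_simps power2_eq_square)
  qed
  finally show ?thesis by (simp add: R_def)
qed

section \<open>The Hessian of the potential\<close>

lemma pd_cong_ev:
  assumes "\<forall>\<^sub>F \<tau> in nhds (x k). f (x(k := \<tau>)) = q \<tau>" "(q has_real_derivative y) (at (x k))"
  shows "pd k f x = y"
  by (rule pdI) (use assms DERIV_cong_ev[OF refl assms(1) refl] in simp)

lemma deriv_even_eq_0:
  fixes p :: "real \<Rightarrow> real"
  assumes "p differentiable (at 0)" "\<And>\<tau>. p (- \<tau>) = p \<tau>"
  shows "deriv p 0 = 0"
proof -
  obtain y where y: "(p has_real_derivative y) (at 0)"
    using assms(1) by (auto simp: real_differentiable_def)
  then have "((\<lambda>\<tau>. p (- \<tau>)) has_real_derivative - y) (at 0)"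
    using DERIV_mirror[of p y 0] by simp
  then have "y = - y" using y unfolding assms(2) by (rule DERIV_unique[rotated])
  then show ?thesis using DERIV_imp_deriv[OF y] by simp
qed

text \<open>A positive derivative would make \<open>p\<close> positive just to the right of 0;
  one-sided information suffices.\<close>

lemma deriv_nonpos_right:
  fixes p :: "real \<Rightarrow> real"
  assumes "(p has_real_derivative y) (at 0)" "p 0 = 0" "\<And>\<tau>. 0 < \<tau> \<Longrightarrow> p \<tau> \<le> 0"
  shows "y \<le> 0"
proof (rule ccontr)
  assume "\<not> y \<le> 0"
  then obtain e where "0 < e" "\<And>\<tau>. 0 < \<tau> \<Longrightarrow> \<tau> < e \<Longrightarrow> p 0 < p (0 + \<tau>)"
    using DERIV_pos_inc_right[OF assms(1)] by auto
  from this(2)[of "e / 2"] show False using \<open>0 < e\<close> assms(2) assms(3)[of "e / 2"] by simp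
qed

lemma riemannian_metric_pd:
  assumes "riemannian_metric M g" "c \<in> atlas M" "p \<in> fst c"
  shows "mat_pd (coords M) (g c p)"
    and "\<And>k l. k \<in> coords M \<Longrightarrow> l \<in> coords M \<Longrightarrow> g c p k l = g c p l k"
  using assms unfolding riemannian_metric_def mat_pd_def by blast+

lemma mat_pd_nonneg:
  assumes "mat_pd I A"
  shows "0 \<le> (\<Sum>k\<in>I. \<Sum>l\<in>I. A k l * v k * v l)"
proof (cases "\<exists>k\<in>I. v k \<noteq> 0")
  case True
  then show ?thesis using assms by (simp add: mat_pd_def less_imp_le)
next
  case False
  then show ?thesis by (intro sum_nonneg) auto
qed

lemma smooth_manifold_chartD:
  assumes "smooth_manifold M" "c \<in> atlas M"
  shows "inj_on (snd c) (fst c)"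
    and "openin (powertop_real (coords M)) (snd c ` fst c)"
    and "p \<in> fst c \<Longrightarrow> snd c p \<in> extensional (coords M)"
proof -
  have op: "openin (mtop M) (fst c)" "openin (powertop_real (coords M)) (snd c ` fst c)"
    and hom: "homeomorphic_map (subtopology (mtop M) (fst c))
       (subtopology (powertop_real (coords M)) (snd c ` fst c)) (snd c)"
    using assms by (simp_all add: smooth_manifold_def case_prod_beta')
  show "openin (powertop_real (coords M)) (snd c ` fst c)" by (rule op)
  have "topspace (subtopology (mtop M) (fst c)) = fst c"
    using openin_subset[OF op(1)] by (simp add: topspace_subtopology Int_absorb1)
  then show "inj_on (snd c) (fst c)"
    using homeomorphic_imp_injective_map[OF hom] by simp
  show "snd c p \<in> extensional (coords M)" if "p \<in> fst c"
    using openin_subset[OF op(2)] that by (auto simp: PiE_def)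
qed

lemma continuous_map_upd:
  assumes "p \<in> extensional K" "k \<in> K"
  shows "continuous_map euclideanreal (powertop_real K) (\<lambda>\<tau>. p(k := \<tau>))"
proof -
  have "continuous_map euclideanreal euclideanreal (\<lambda>\<tau>. (p(k := \<tau>)) l)" for l
    by (cases "l = k") auto
  moreover have "p(k := \<tau>) \<in> extensional K" for \<tau>
    using assms by (auto simp: extensional_def)
  ultimately show ?thesis by (auto simp: continuous_map_componentwise simp del: fun_upd_apply)
qed

lemma eventually_upd_in_open:
  assumes "openin (powertop_real K) W" "p \<in> W" "k \<in> K"
  shows "\<forall>\<^sub>F \<tau> in nhds (p k). p(k := \<tau>) \<in> W"
proof -
  have "p \<in> extensional K" using openin_subset[OF assms(1)] assms(2) by (auto simp: PiE_def)
  from openin_continuous_map_preimage[OF continuous_map_upd[OF this assms(3)] assms(1)]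
  have "open {\<tau>. p(k := \<tau>) \<in> W}" by simp
  from eventually_nhds_in_open[OF this, of "p k"] show ?thesis using assms(2) by simp
qed

text \<open>One product chart, with \<open>D\<close>, \<open>D'\<close> and \<open>w'\<close>
  standing for u', u'' and the derivatives of the warping functions. The trajectory enters only
  through the sign conditions.\<close>

locale warped_chart =
  fixes r :: nat and d :: "nat \<Rightarrow> nat"
    and M :: "nat \<Rightarrow> ('a, nat) mfd" and h :: "nat \<Rightarrow> ('a, nat) tensor2"
    and w w' :: "nat \<Rightarrow> real \<Rightarrow> real" and u D D' :: "real \<Rightarrow> real"
    and g :: "((nat \<Rightarrow> real) \<times> (nat \<Rightarrow> 'a), nat + nat \<times> nat) tensor2"
    and f :: "(nat \<Rightarrow> real) \<times> (nat \<Rightarrow> 'a) \<Rightarrow> real"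
    and c :: "nat \<Rightarrow> ('a, nat) chart"
  assumes mfd: "\<And>i. i \<in> {2..r} \<Longrightarrow> smooth_manifold (M i)"
    and metric: "\<And>i. i \<in> {2..r} \<Longrightarrow> riemannian_metric (M i) (h i)"
    and chart: "\<And>i. i \<in> {2..r} \<Longrightarrow> c i \<in> atlas (M i)"
    and total_metric: "riemannian_metric (total_space r d M) g"
    and smooth_f: "smooth_fun (total_space r d M) f"
    and extends: "extends_warped r d M h w u g f"
    and r: "1 \<le> r"
    and deru: "\<And>\<rho>. 0 < \<rho> \<Longrightarrow> (u has_real_derivative D \<rho>) (at \<rho>)"
    and derD: "\<And>\<rho>. 0 < \<rho> \<Longrightarrow> (D has_real_derivative D' \<rho>) (at \<rho>)"
    and D_nonpos: "\<And>\<rho>. 0 < \<rho> \<Longrightarrow> D \<rho> \<le> 0" and D'_nonpos: "\<And>\<rho>. 0 < \<rho> \<Longrightarrow> D' \<rho> \<le> 0"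
    and derw: "\<And>i \<rho>. i \<in> {1..r} \<Longrightarrow> 0 < \<rho> \<Longrightarrow> (w i has_real_derivative w' i \<rho>) (at \<rho>)"
    and w_mono: "\<And>i \<rho>. i \<in> {1..r} \<Longrightarrow> 0 < \<rho> \<Longrightarrow> 0 \<le> w i \<rho> * w' i \<rho>"
begin

section \<open>Coordinates of the product chart\<close>

definition "n = d 1 + 1"
abbreviation "J \<equiv> Sigma {2..r} (\<lambda>i. coords (M i))"
abbreviation "I \<equiv> {..<n} <+> J"
abbreviation "U \<equiv> fst (total_chart r d M c)"
abbreviation "\<phi> \<equiv> snd (total_chart r d M c)"
abbreviation "F \<equiv> \<lambda>z. f (inv_into U \<phi> z)"
abbreviation "G \<equiv> loc g (total_chart r d M c)"

lemma n_pos: "0 < n"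
  by (simp add: n_def)

lemma coords_total: "coords (total_space r d M) = I"
  by (simp add: n_def total_space_def prod_mfd_def euclid_def fam_prod_mfd_def)

lemma total_chart_atlas: "total_chart r d M c \<in> atlas (total_space r d M)"
proof -
  have "({..<n} \<rightarrow>\<^sub>E UNIV, \<lambda>x. x) \<in> atlas (euclid n)" by (simp add: euclid_def)
  moreover have "fam_chart {2..r} (\<lambda>i. coords (M i)) c \<in> atlas (fam_prod_mfd {2..r} M)"
    using chart by (auto simp: fam_prod_mfd_def)
  ultimately have "pair_chart (coords (euclid n)) (coords (fam_prod_mfd {2..r} M))
      ({..<n} \<rightarrow>\<^sub>E UNIV, \<lambda>x. x) (fam_chart {2..r} (\<lambda>i. coords (M i)) c) \<in> atlas (total_space r d M)"
    unfolding total_space_def prod_mfd_def n_def[symmetric] mfd.simps mem_Collect_eq by blast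
  then show ?thesis by (simp add: total_chart_def euclid_def fam_prod_mfd_def n_def)
qed

lemma finite_J: "finite J"
  using mfd by (intro finite_SigmaI) (auto simp: smooth_manifold_def)

lemma finite_I: "finite I"
  using finite_J by simp

lemma U_iff: "(x, m) \<in> U \<longleftrightarrow> x \<in> extensional {..<n} \<and> m \<in> (\<Pi>\<^sub>E i\<in>{2..r}. fst (c i))"
  by (auto simp: n_def total_chart_def pair_chart_def fam_chart_def PiE_def)

lemma \<phi>_def': "\<phi> (x, m) = restrict (\<lambda>j. case j of Inl k \<Rightarrow> x k | Inr (i, k) \<Rightarrow> snd (c i) (m i) k) I"
  by (rule ext) (auto simp: n_def total_chart_def pair_chart_def fam_chart_def restrict_def split: sum.splits)

lemma \<phi>_Inl: "k < n \<Longrightarrow> \<phi> (x, m) (Inl k) = x k"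
  and \<phi>_Inr: "(i, k) \<in> J \<Longrightarrow> \<phi> (x, m) (Inr (i, k)) = snd (c i) (m i) k"
  unfolding \<phi>_def' by auto

text \<open>Makes \<open>inv_into U \<phi>\<close> a true inverse on the chart. Extensionality of
  points and chart values turns equal coordinates into equal points.\<close>

lemma inj_\<phi>: "inj_on \<phi> U"
proof (rule inj_onI, clarify)
  fix x m x' m' assume U: "(x, m) \<in> U" "(x', m') \<in> U" and eq: "\<phi> (x, m) = \<phi> (x', m')"
  have "x k = x' k" if "k < n" for k using that \<phi>_Inl eq by metis
  then have "x = x'" using U by (intro extensionalityI[of _ "{..<n}"]) (auto simp: U_iff)
  moreover have "m i = m' i" if i: "i \<in> {2..r}" for i
  proof -
    note ch = smooth_manifold_chartD[OF mfd[OF i] chart[OF i]]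
    have mi: "m i \<in> fst (c i)" "m' i \<in> fst (c i)" using U i by (auto simp: U_iff)
    have "snd (c i) (m i) k = snd (c i) (m' i) k" if "k \<in> coords (M i)" for k
      using \<phi>_Inr[of i k] eq that i by (metis SigmaI)
    then have "snd (c i) (m i) = snd (c i) (m' i)"
      using ch(3) mi by (intro extensionalityI[of _ "coords (M i)"]) auto
    then show ?thesis using ch(1) mi by (auto dest: inj_onD)
  qed
  then have "m = m'" using U by (intro PiE_ext[of m "{2..r}" _ m']) (auto simp: U_iff)
  ultimately show "x = x' \<and> m = m'" by simp
qed

lemma F_\<phi>: "(x, m) \<in> U \<Longrightarrow> F (\<phi> (x, m)) = f (x, m)"
  and G_\<phi>: "(x, m) \<in> U \<Longrightarrow> G (\<phi> (x, m)) = g (total_chart r d M c) (x, m)"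
  by (simp_all add: loc_def inv_into_f_f[OF inj_\<phi>])

lemma upd_Inl:
  assumes "(x, m) \<in> U" "k < n"
  shows "(x(k := \<tau>), m) \<in> U" "(\<phi> (x, m))(Inl k := \<tau>) = \<phi> (x(k := \<tau>), m)"
  using assms by (auto simp: U_iff extensional_def \<phi>_def' restrict_def fun_eq_iff split: sum.splits)

text \<open>Varying a coordinate of a factor \<open>M i\<close> moves only the point of that factor,
  which stays in its chart because the chart image is open. In particular \<open>x\<close> and its
  radius stay fixed.\<close>

lemma upd_Inr:
  assumes U: "(x, m) \<in> U" and j: "j \<in> J"
  shows "\<forall>\<^sub>F \<tau> in nhds (\<phi> (x, m) (Inr j)). \<exists>m'. (x, m') \<in> U \<and> (\<phi> (x, m))(Inr j := \<tau>) = \<phi> (x, m')"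
proof -
  obtain i k where j: "j = (i, k)" "i \<in> {2..r}" "k \<in> coords (M i)" using j by auto
  have mi: "m i \<in> fst (c i)" using U j by (auto simp: U_iff)
  have "\<forall>\<^sub>F \<tau> in nhds (snd (c i) (m i) k). (snd (c i) (m i))(k := \<tau>) \<in> snd (c i) ` fst (c i)"
    using mi j by (intro eventually_upd_in_open[OF smooth_manifold_chartD(2)[OF mfd chart]]) auto
  moreover have "\<phi> (x, m) (Inr j) = snd (c i) (m i) k" using j by (simp add: \<phi>_Inr)
  ultimately have "\<forall>\<^sub>F \<tau> in nhds (\<phi> (x, m) (Inr j)). (snd (c i) (m i))(k := \<tau>) \<in> snd (c i) ` fst (c i)"
    by simp
  then show ?thesis
  proof (rule eventually_mono)
    fix \<tau> assume "(snd (c i) (m i))(k := \<tau>) \<in> snd (c i) ` fst (c i)"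
    then obtain q where q: "q \<in> fst (c i)" "snd (c i) q = (snd (c i) (m i))(k := \<tau>)" by auto
    have "(x, m(i := q)) \<in> U" using U q j by (auto simp: U_iff PiE_def extensional_def)
    moreover have "(\<phi> (x, m))(Inr j := \<tau>) = \<phi> (x, m(i := q))"
      using q j by (auto simp: \<phi>_def' restrict_def fun_eq_iff split: sum.splits)
    ultimately show "\<exists>m'. (x, m') \<in> U \<and> (\<phi> (x, m))(Inr j := \<tau>) = \<phi> (x, m')" by blast
  qed
qed

lemma pd_Inl:
  assumes "(x, m) \<in> U" "k < n" "((\<lambda>\<tau>. T (\<phi> (x(k := \<tau>), m))) has_real_derivative y) (at (x k))"
  shows "pd (Inl k) T (\<phi> (x, m)) = y"
  by (rule pdI) (use assms upd_Inl(2)[OF assms(1,2)] \<phi>_Inl[OF assms(2)] in simp)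

lemma pd_Inl_pos:
  assumes U: "(x, m) \<in> U" and k: "k < n" and pos: "0 < rad n x"
    and T: "\<And>x'. (x', m) \<in> U \<Longrightarrow> 0 < rad n x' \<Longrightarrow> T (\<phi> (x', m)) = Q x'"
    and Q: "((\<lambda>\<tau>. Q (x(k := \<tau>))) has_real_derivative y) (at (x k))"
  shows "pd (Inl k) T (\<phi> (x, m)) = y"
proof (rule pd_cong_ev)
  show "\<forall>\<^sub>F \<tau> in nhds (\<phi> (x, m) (Inl k)). T ((\<phi> (x, m))(Inl k := \<tau>)) = Q (x(k := \<tau>))"
    using eventually_rad_upd_pos[OF k pos] unfolding \<phi>_Inl[OF k]
    by eventually_elim (simp add: upd_Inl[OF U k] T)
qed (simp add: Q \<phi>_Inl[OF k])

lemma pd_Inr_const: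
  assumes "(x, m) \<in> U" "j \<in> J" "\<And>m'. (x, m') \<in> U \<Longrightarrow> T (\<phi> (x, m')) = e"
  shows "pd (Inr j) T (\<phi> (x, m)) = 0"
proof (rule pd_cong_ev)
  show "\<forall>\<^sub>F \<tau> in nhds (\<phi> (x, m) (Inr j)). T ((\<phi> (x, m))(Inr j := \<tau>)) = e"
    using upd_Inr[OF assms(1,2)] by eventually_elim (auto simp: assms(3))
qed simp

section \<open>The potential and its first derivatives\<close>

lemma F_pos: "(x, m) \<in> U \<Longrightarrow> 0 < rad n x \<Longrightarrow> F (\<phi> (x, m)) = u (rad n x)"
  using extends chart unfolding F_\<phi> extends_warped_def n_def by blast

lemma G_pos:
  "(x, m) \<in> U \<Longrightarrow> 0 < rad n x \<Longrightarrow> a \<in> I \<Longrightarrow> b \<in> I \<Longrightarrow>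
     G (\<phi> (x, m)) a b = warped_metric d w h c (x, m) a b"
  using extends chart unfolding G_\<phi> extends_warped_def coords_total n_def by blast

lemma F_differentiable:
  assumes "z \<in> \<phi> ` U" "j \<in> I"
  shows "(\<lambda>\<tau>. F (z(j := \<tau>))) differentiable (at (z j))"
    and "l \<in> I \<Longrightarrow> (\<lambda>\<tau>. pd l F (z(j := \<tau>))) differentiable (at (z j))"
proof -
  have "smooth_on I (\<phi> ` U) F"
    using smooth_f total_chart_atlas unfolding smooth_fun_def coords_total by (auto split: prod.splits)
  \<comment> \<open>Order two covers one derivative of \<open>F\<close> and one of each of its
    partial derivatives.\<close>
  then have "Ck_on (Suc (Suc 0)) I (\<phi> ` U) F" by (simp only: smooth_on_def)
  then show "(\<lambda>\<tau>. F (z(j := \<tau>))) differentiable (at (z j))"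
    "l \<in> I \<Longrightarrow> (\<lambda>\<tau>. pd l F (z(j := \<tau>))) differentiable (at (z j))"
    unfolding Ck_on.simps using assms by blast+
qed

lemma F_differentiable_Inl:
  assumes "(x, m) \<in> U" "k < n"
  shows "(\<lambda>\<tau>. F (\<phi> (x(k := \<tau>), m))) differentiable (at (x k))"
    and "l \<in> I \<Longrightarrow> (\<lambda>\<tau>. pd l F (\<phi> (x(k := \<tau>), m))) differentiable (at (x k))"
  using F_differentiable(1)[of "\<phi> (x, m)" "Inl k"] F_differentiable(2)[of "\<phi> (x, m)" "Inl k" l] assms
  by (simp_all add: upd_Inl[OF assms] \<phi>_Inl InlI)

lemma rad_upd_zero:
  assumes "rad n x = 0" "k < n" "0 \<le> \<tau>"
  shows "rad n (x(k := \<tau>)) = \<tau>"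
proof -
  have "(\<Sum>l<n. ((x(k := \<tau>)) l)\<^sup>2) = (\<Sum>l<n. if l = k then \<tau>\<^sup>2 else 0)"
    using assms(1) unfolding rad_eq_0_iff by (intro sum.cong) auto
  then show ?thesis using assms(2,3) by (simp add: rad_def)
qed

text \<open>On the core \<open>f\<close> is not prescribed by \<open>u\<close>, so its value is
  recovered by continuity along the first Cartesian axis.\<close>

lemma u_tendsto_F_zero:
  assumes U: "(x, m) \<in> U" and zero: "rad n x = 0"
  shows "(u \<longlongrightarrow> F (\<phi> (x, m))) (at_right 0)"
proof -
  have x0: "x 0 = 0" using zero n_pos by (simp add: rad_eq_0_iff)
  have "isCont (\<lambda>\<tau>. F (\<phi> (x(0 := \<tau>), m))) 0"
    using F_differentiable_Inl(1)[OF U, of 0] x0 n_pos by (simp add: differentiable_imp_continuous_within)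
  then have "((\<lambda>\<tau>. F (\<phi> (x(0 := \<tau>), m))) \<longlongrightarrow> F (\<phi> (x, m))) (at_right 0)"
    using x0 fun_upd_idem[of x 0 0] by (simp add: isCont_def filterlim_at_split)
  then show ?thesis
  proof (rule Lim_transform_eventually)
    show "\<forall>\<^sub>F \<tau> in at_right 0. F (\<phi> (x(0 := \<tau>), m)) = u \<tau>"
      using eventually_at_right_less[of 0]
      by eventually_elim (simp add: n_pos F_pos[OF upd_Inl(1)[OF U]] rad_upd_zero[OF zero])
  qed
qed

text \<open>At radius 0 both values are the limit of \<open>u\<close> at 0, and limits are unique;
  elsewhere both equal \<open>u\<close> of the radius.\<close>

lemma F_radial:
  assumes "(x, m) \<in> U" "(x', m') \<in> U" "rad n x = rad n x'"
  shows "F (\<phi> (x, m)) = F (\<phi> (x', m'))"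
proof (cases "rad n x = 0")
  case True
  then show ?thesis
    using u_tendsto_F_zero assms by (intro tendsto_unique[OF _ u_tendsto_F_zero u_tendsto_F_zero]) auto
next
  case False
  then have "0 < rad n x" using rad_nonneg[of n x] by linarith
  then show ?thesis using F_pos assms by simp
qed

lemma pd_F_Inr: "(x, m) \<in> U \<Longrightarrow> j \<in> J \<Longrightarrow> pd (Inr j) F (\<phi> (x, m)) = 0"
  by (rule pd_Inr_const[where e = "F (\<phi> (x, m))"]) (auto intro: F_radial)

lemma pd_F_Inl:
  assumes U: "(x, m) \<in> U" and "0 < rad n x" "k < n"
  shows "pd (Inl k) F (\<phi> (x, m)) = D (rad n x) * (x k / rad n x)"
proof (rule pd_Inl_pos[OF U assms(3,2), where Q = "\<lambda>x. u (rad n x)"])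
  show "((\<lambda>\<tau>. u (rad n (x(k := \<tau>)))) has_real_derivative D (rad n x) * (x k / rad n x)) (at (x k))"
    by (rule radial_upd_deriv[OF assms(3,2) deru[OF assms(2)]])
qed (simp add: F_pos)

text \<open>Reflecting one Cartesian coordinate preserves the radius, so \<open>F\<close> is even in
  that coordinate.\<close>

lemma pd_F_Inl_zero:
  assumes U: "(x, m) \<in> U" and k: "k < n" and zero: "x k = 0"
  shows "pd (Inl k) F (\<phi> (x, m)) = 0"
proof -
  let ?p = "\<lambda>\<tau>. F (\<phi> (x(k := \<tau>), m))"
  have diff: "?p differentiable (at 0)" using F_differentiable_Inl(1)[OF U k] zero by simp
  have "?p (- \<tau>) = ?p \<tau>" for \<tau>
  proof (rule F_radial)
    show "rad n (x(k := - \<tau>)) = rad n (x(k := \<tau>))"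
      unfolding rad_def by (intro arg_cong[where f=sqrt] sum.cong) auto
  qed (use upd_Inl(1)[OF U k] in auto)
  from deriv_even_eq_0[OF diff this] have "deriv ?p 0 = 0" .
  moreover have "(?p has_real_derivative deriv ?p 0) (at 0)"
    using diff by (simp add: DERIV_deriv_iff_real_differentiable)
  ultimately show ?thesis using zero by (intro pd_Inl[OF U k]) simp
qed

section \<open>The Hessian on the core\<close>

abbreviation "Hs \<equiv> hess_loc I G F"

text \<open>All first derivatives of \<open>F\<close> vanish on the core, which removes the
  Christoffel terms. Mixed derivatives vanish because the inner derivative is zero along the outer
  coordinate line, and the diagonal ones take their sign from u'.\<close>

lemma hess_zero:
  assumes U: "(x, m) \<in> U" and zero: "rad n x = 0" and I: "a \<in> I" "b \<in> I"
  shows "Hs (\<phi> (x, m)) a b = pd a (pd b F) (\<phi> (x, m))"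
    and "a \<noteq> b \<Longrightarrow> pd a (pd b F) (\<phi> (x, m)) = 0"
    and "pd a (pd a F) (\<phi> (x, m)) \<le> 0"
proof -
  have x0: "x k = 0" if "k < n" for k using zero that by (simp add: rad_eq_0_iff)
  have pd0: "pd e F (\<phi> (x, m')) = 0" if "e \<in> I" "(x, m') \<in> U" for e m'
    using that x0 by (auto simp: pd_F_Inr pd_F_Inl_zero)
  show "Hs (\<phi> (x, m)) a b = pd a (pd b F) (\<phi> (x, m))"
    unfolding hess_loc_def using pd0 U by simp
  show off: "pd a (pd b F) (\<phi> (x, m)) = 0" if "a \<noteq> b"
  proof (cases a)
    case (Inr j)
    then show ?thesis using I U pd0 by (auto intro!: pd_Inr_const)
  next
    case (Inl k)
    then have k: "k < n" using I by auto
    \<comment> \<open>Moving along axis \<open>k\<close> leaves every other Cartesian coordinate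
      equal to 0, so evenness in that coordinate still applies.\<close>
    have "pd b F (\<phi> (x(k := \<tau>), m)) = 0" for \<tau>
      using I upd_Inl(1)[OF U k] that Inl x0 by (cases b) (auto simp: pd_F_Inr pd_F_Inl_zero)
    then show ?thesis unfolding Inl by (intro pd_Inl[OF U k]) simp
  qed
  show "pd a (pd a F) (\<phi> (x, m)) \<le> 0"
  proof (cases a)
    case (Inr j)
    then have "pd a (pd a F) (\<phi> (x, m)) = 0" using I U pd0 by (auto intro!: pd_Inr_const)
    then show ?thesis by simp
  next
    case (Inl k)
    then have k: "k < n" using I by auto
    let ?p = "\<lambda>\<tau>. pd (Inl k) F (\<phi> (x(k := \<tau>), m))"
    have p: "(?p has_real_derivative deriv ?p 0) (at 0)"
      using F_differentiable_Inl(2)[OF U k, of "Inl k"] k x0[OF k]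
      by (simp add: InlI DERIV_deriv_iff_real_differentiable)
    have "deriv ?p 0 \<le> 0"
    proof (rule deriv_nonpos_right[OF p])
      show "?p 0 = 0" using pd_F_Inl_zero[OF upd_Inl(1)[OF U k] k] by simp
      fix \<tau> :: real assume "0 < \<tau>"
      \<comment> \<open>On the positive half of the axis the radius is \<open>\<tau>\<close>, and
        the partial derivative is \<open>D \<tau>\<close>.\<close>
      then show "?p \<tau> \<le> 0"
        using pd_F_Inl[OF upd_Inl(1)[OF U k] _ k, of \<tau>] rad_upd_zero[OF zero k, of \<tau>] D_nonpos by simp
    qed
    moreover have "pd (Inl k) (pd (Inl k) F) (\<phi> (x, m)) = deriv ?p 0"
      using p x0[OF k] by (intro pd_Inl[OF U k]) simp
    ultimately show ?thesis by (simp add: Inl)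
  qed
qed

lemma hess_nonpos_zero:
  assumes U: "(x, m) \<in> U" and zero: "rad n x = 0"
  shows "(\<Sum>a\<in>I. \<Sum>b\<in>I. Hs (\<phi> (x, m)) a b * v a * v b) \<le> 0"
proof -
  let ?z = "\<phi> (x, m)"
  have "(\<Sum>a\<in>I. \<Sum>b\<in>I. Hs ?z a b * v a * v b)
     = (\<Sum>a\<in>I. \<Sum>b\<in>I. if a = b then pd a (pd a F) ?z * (v a * v a) else 0)"
    using hess_zero[OF assms] by (intro sum.cong) auto
  also have "\<dots> = (\<Sum>a\<in>I. pd a (pd a F) ?z * (v a * v a))"
    by (intro sum.cong refl) (subst sum.delta'[OF finite_I], simp)
  also have "\<dots> \<le> 0"
    using hess_zero(3)[OF assms] by (intro sum_nonpos mult_nonpos_nonneg) auto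
  finally show ?thesis .
qed

section \<open>The metric and the Hessian off the core\<close>

definition "N x k = x k / rad n x"
definition "\<delta> k l = (if k = l then 1 else 0 :: real)" for k l :: nat

lemma sum_\<delta>: "k < n \<Longrightarrow> (\<Sum>m<n. \<delta> k m * A m) = A k"
  and sum_\<delta>': "k < n \<Longrightarrow> (\<Sum>m<n. \<delta> m k * A m) = A k"
  and \<delta>_commute: "\<delta> k l = \<delta> l k"
  unfolding \<delta>_def using sum_delta_times[of k n A] by (simp_all add: eq_commute[of _ k])

lemma sum_N_sq: "0 < rad n x \<Longrightarrow> (\<Sum>k<n. N x k * N x k) = 1"
  by (simp add: N_def rad_sq[symmetric] sum_divide_distrib[symmetric] power2_eq_square[symmetric] power_divide)

lemma coord_N: "0 < rad n x \<Longrightarrow> x k = rad n x * N x k"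
  by (simp add: N_def)

lemma hess_F_Inl:
  assumes U: "(x, m) \<in> U" and pos: "0 < rad n x" and k: "k < n" and l: "l < n"
  shows "pd (Inl k) (pd (Inl l) F) (\<phi> (x, m)) =
    D' (rad n x) * (N x k * N x l) + D (rad n x) * ((\<delta> k l - N x k * N x l) / rad n x)"
proof (rule pd_Inl_pos[OF U k pos, where Q = "\<lambda>x. D (rad n x) * (x l / rad n x)"])
  show "((\<lambda>\<tau>. D (rad n (x(k := \<tau>))) * ((x(k := \<tau>)) l / rad n (x(k := \<tau>)))) has_real_derivative
    D' (rad n x) * (N x k * N x l) + D (rad n x) * ((\<delta> k l - N x k * N x l) / rad n x)) (at (x k))"
    by (rule DERIV_cong[OF DERIV_mult[OF radial_upd_deriv[OF k pos derD[OF pos]]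
            DERIV_divide[OF coord_upd_deriv rad_upd_deriv[OF k pos]]]])
      (use pos in \<open>auto simp: N_def \<delta>_def field_simps power2_eq_square\<close>)
qed (use l pd_F_Inl in auto)

text \<open>The factor by which the metric scales Euclidean directions orthogonal to the
  radius.\<close>

definition "q \<rho> = (w 1 \<rho> / \<rho>)\<^sup>2"
text \<open>The derivative of \<open>q\<close>, arranged to keep the product
  \<open>w 1 \<rho> * w' 1 \<rho>\<close> intact, since its sign is what is known.\<close>

definition "q' \<rho> = 2 * (w 1 \<rho> * w' 1 \<rho>) / \<rho>\<^sup>2 - 2 * q \<rho> / \<rho>"

lemma derq: "0 < \<rho> \<Longrightarrow> (q has_real_derivative q' \<rho>) (at \<rho>)"
  unfolding q_def[abs_def] q'_def using derw[of 1 \<rho>] r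
  by (auto intro!: derivative_eq_intros simp: power2_eq_square field_simps)

text \<open>Radial functions times polynomials in the coordinates, a form suited to differentiation;
  \<open>G_Inl_N\<close> is the form for contraction.\<close>

lemma G_Inl_Inl:
  assumes "(x, m) \<in> U" "0 < rad n x" "k < n" "l < n"
  shows "G (\<phi> (x, m)) (Inl k) (Inl l) = (1 - q (rad n x)) / (rad n x)\<^sup>2 * (x k * x l) + q (rad n x) * \<delta> k l"
proof -
  have "G (\<phi> (x, m)) (Inl k) (Inl l) = x k / rad n x * (x l / rad n x)
     + (w 1 (rad n x))\<^sup>2 * ((\<delta> k l - x k * x l / (rad n x)\<^sup>2) / (rad n x)\<^sup>2)"
    using assms G_pos[of x m "Inl k" "Inl l"]
    by (simp add: InlI warped_metric_def Let_def n_def[symmetric] pd_rad round_pullback_eq \<delta>_def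
        del: One_nat_def)
  also have "\<dots> = (1 - q (rad n x)) / (rad n x)\<^sup>2 * (x k * x l) + q (rad n x) * \<delta> k l"
    using assms(2) by (simp add: q_def field_simps power2_eq_square)
  finally show ?thesis .
qed

lemma G_Inl_N:
  assumes "(x, m) \<in> U" "0 < rad n x" "k < n" "l < n"
  shows "G (\<phi> (x, m)) (Inl k) (Inl l) = N x k * N x l + q (rad n x) * (\<delta> k l - N x k * N x l)"
  unfolding G_Inl_Inl[OF assms] using assms(2) by (simp add: N_def field_simps power2_eq_square)

lemma G_mixed:
  assumes "(x, m) \<in> U" "0 < rad n x" "k < n" "j \<in> J"
  shows "G (\<phi> (x, m)) (Inl k) (Inr j) = 0" "G (\<phi> (x, m)) (Inr j) (Inl k) = 0"
  using assms G_pos[of x m "Inl k" "Inr j"] G_pos[of x m "Inr j" "Inl k"]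
  by (auto simp: InlI InrI warped_metric_def Let_def split: prod.splits)

lemma G_Inr:
  assumes "(x, m) \<in> U" "0 < rad n x" "(i, k) \<in> J" "(j, l) \<in> J"
  shows "G (\<phi> (x, m)) (Inr (i, k)) (Inr (j, l)) =
    (if i = j then (w i (rad n x))\<^sup>2 * h i (c i) (m i) k l else 0)"
  using assms G_pos[of x m "Inr (i, k)" "Inr (j, l)"]
  by (auto simp: InrI warped_metric_def Let_def n_def)

lemma pd_G_Inl_Inl:
  assumes U: "(x, m) \<in> U" and pos: "0 < rad n x" and a: "a < n" and k: "k < n" and l: "l < n"
  defines "\<rho> \<equiv> rad n x"
  shows "pd (Inl a) (\<lambda>y. G y (Inl k) (Inl l)) (\<phi> (x, m)) =
    (- q' \<rho> - 2 * (1 - q \<rho>) / \<rho>) * (N x a * N x k * N x l)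
    + (1 - q \<rho>) / \<rho> * (\<delta> a k * N x l + \<delta> a l * N x k) + q' \<rho> * (N x a * \<delta> k l)"
proof (rule pd_Inl_pos[OF U a pos, where Q = "\<lambda>x. (1 - q (rad n x)) / (rad n x)\<^sup>2 * (x k * x l) + q (rad n x) * \<delta> k l"])
  have \<rho>: "0 < \<rho>" using pos by (simp add: \<rho>_def)
  have 1: "((\<lambda>\<rho>. (1 - q \<rho>) / \<rho>\<^sup>2) has_real_derivative (- q' \<rho> - 2 * (1 - q \<rho>) / \<rho>) / \<rho>\<^sup>2) (at (rad n x))"
    unfolding \<rho>_def[symmetric] using \<rho>
    by (auto intro!: derivative_eq_intros derq simp: power2_eq_square field_simps)
  have 2: "(q has_real_derivative q' \<rho>) (at (rad n x))" using derq[OF \<rho>] by (simp add: \<rho>_def)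
  show "((\<lambda>\<tau>. (1 - q (rad n (x(a := \<tau>)))) / (rad n (x(a := \<tau>)))\<^sup>2 * ((x(a := \<tau>)) k * (x(a := \<tau>)) l)
       + q (rad n (x(a := \<tau>))) * \<delta> k l) has_real_derivative
    (- q' \<rho> - 2 * (1 - q \<rho>) / \<rho>) * (N x a * N x k * N x l)
    + (1 - q \<rho>) / \<rho> * (\<delta> a k * N x l + \<delta> a l * N x k) + q' \<rho> * (N x a * \<delta> k l)) (at (x a))"
  proof (rule DERIV_cong[OF DERIV_add[OF DERIV_mult[OF radial_upd_deriv[OF a pos 1]
            DERIV_mult[OF coord_upd_deriv coord_upd_deriv]] DERIV_cmult_right[OF radial_upd_deriv[OF a pos 2]]]])
    have "(x(a := x a)) e = \<rho> * N x e" for e using coord_N[OF pos] by (simp add: \<rho>_def)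
    moreover have "rad n (x(a := x a)) = \<rho>" "x a / rad n x = N x a" by (simp_all add: \<rho>_def N_def)
    ultimately show "(- q' \<rho> - 2 * (1 - q \<rho>) / \<rho>) / \<rho>\<^sup>2 * (x a / rad n x) * ((x(a := x a)) k * (x(a := x a)) l)
      + ((if a = k then 1 else 0) * (x(a := x a)) l + (if a = l then 1 else 0) * (x(a := x a)) k)
        * ((1 - q (rad n (x(a := x a)))) / (rad n (x(a := x a)))\<^sup>2)
      + q' \<rho> * (x a / rad n x) * \<delta> k l
      = (- q' \<rho> - 2 * (1 - q \<rho>) / \<rho>) * (N x a * N x k * N x l)
    + (1 - q \<rho>) / \<rho> * (\<delta> a k * N x l + \<delta> a l * N x k) + q' \<rho> * (N x a * \<delta> k l)"
      unfolding \<delta>_def[symmetric] using \<rho> by (simp add: field_simps power2_eq_square)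
  qed
qed (use k l G_Inl_Inl in auto)

text \<open>As \<open>N\<close> has Euclidean length 1, only multiples of
  \<open>\<delta> k l\<close> and \<open>N x k * N x l\<close> survive; their coefficients are
  opposite, so the radial direction drops out.\<close>

lemma christoffel_N_Inl_Inl:
  assumes U: "(x, m) \<in> U" and pos: "0 < rad n x" and k: "k < n" and l: "l < n"
  defines "\<rho> \<equiv> rad n x"
  shows "(\<Sum>a<n. N x a * (pd (Inl k) (\<lambda>y. G y (Inl a) (Inl l)) (\<phi> (x, m))
      + pd (Inl l) (\<lambda>y. G y (Inl a) (Inl k)) (\<phi> (x, m)) - pd (Inl a) (\<lambda>y. G y (Inl k) (Inl l)) (\<phi> (x, m))))
    = (2 * (1 - q \<rho>) / \<rho> - q' \<rho>) * (\<delta> k l - N x k * N x l)"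
proof -
  define A B where "A = - q' \<rho> - 2 * (1 - q \<rho>) / \<rho>" and "B = (1 - q \<rho>) / \<rho>"
  note pdG = pd_G_Inl_Inl[OF U pos, folded \<rho>_def, folded A_def B_def]
  have "(\<Sum>a<n. N x a * (pd (Inl k) (\<lambda>y. G y (Inl a) (Inl l)) (\<phi> (x, m))
      + pd (Inl l) (\<lambda>y. G y (Inl a) (Inl k)) (\<phi> (x, m)) - pd (Inl a) (\<lambda>y. G y (Inl k) (Inl l)) (\<phi> (x, m))))
    = (\<Sum>a<n. (A * (N x k * N x l) + 2 * B * \<delta> k l - q' \<rho> * \<delta> k l) * (N x a * N x a)
         + \<delta> a l * (q' \<rho> * N x k * N x a) + \<delta> a k * (q' \<rho> * N x l * N x a))"
  proof (intro sum.cong refl)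
    fix a assume "a \<in> {..<n}"
    then have a: "a < n" by simp
    show "N x a * (pd (Inl k) (\<lambda>y. G y (Inl a) (Inl l)) (\<phi> (x, m))
      + pd (Inl l) (\<lambda>y. G y (Inl a) (Inl k)) (\<phi> (x, m)) - pd (Inl a) (\<lambda>y. G y (Inl k) (Inl l)) (\<phi> (x, m)))
    = (A * (N x k * N x l) + 2 * B * \<delta> k l - q' \<rho> * \<delta> k l) * (N x a * N x a)
         + \<delta> a l * (q' \<rho> * N x k * N x a) + \<delta> a k * (q' \<rho> * N x l * N x a)"
      unfolding pdG[OF k a l] pdG[OF l a k] pdG[OF a k l]
        \<delta>_commute[of k a] \<delta>_commute[of l a] \<delta>_commute[of l k]
      by (simp add: algebra_simps)
  qed
  also have "\<dots> = (A * (N x k * N x l) + 2 * B * \<delta> k l - q' \<rho> * \<delta> k l)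
      + q' \<rho> * N x k * N x l + q' \<rho> * N x l * N x k"
    using k l by (simp only: sum.distrib sum_distrib_left[symmetric] sum_N_sq[OF pos] sum_\<delta>' mult_1_right)
  also have "\<dots> = (2 * (1 - q \<rho>) / \<rho> - q' \<rho>) * (\<delta> k l - N x k * N x l)"
    by (simp add: A_def B_def algebra_simps diff_divide_distrib)
  finally show ?thesis .
qed

text \<open>Serves both as the unit radial vector and as the differential of the radius, whose
  components agree.\<close>

abbreviation "grad x \<equiv> (\<lambda>a :: nat + nat \<times> nat. case a of Inl k \<Rightarrow> N x k | Inr _ \<Rightarrow> 0)"

lemma sum_I: "(\<Sum>a\<in>I. A a) = (\<Sum>k<n. A (Inl k)) + (\<Sum>j\<in>J. A (Inr j))" for A :: "_ \<Rightarrow> real"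
  using sum.Plus[OF _ finite_J, of "{..<n}" A] by simp

text \<open>The differential of \<open>F\<close> is \<open>D\<close> times that of the radius, and
  the metric maps the radial field to its own components, as in the Gauss lemma. Hence
  \<open>christoffel_contract\<close> applies.\<close>

lemma hess_pos:
  assumes U: "(x, m) \<in> U" and pos: "0 < rad n x" and a: "a \<in> I" and b: "b \<in> I"
  shows "Hs (\<phi> (x, m)) a b = pd a (pd b F) (\<phi> (x, m)) - D (rad n x) / 2 *
    (\<Sum>k<n. N x k * (pd a (\<lambda>y. G y (Inl k) b) (\<phi> (x, m)) + pd b (\<lambda>y. G y (Inl k) a) (\<phi> (x, m))
       - pd (Inl k) (\<lambda>y. G y a b) (\<phi> (x, m))))"
proof -
  let ?z = "\<phi> (x, m)"
  note pdsym = riemannian_metric_pd[OF total_metric total_chart_atlas U, unfolded coords_total, folded G_\<phi>[OF U]]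
  have grad: "(\<Sum>b\<in>I. G ?z a b * grad x b) = grad x a" if "a \<in> I" for a
  proof (cases a)
    case (Inl k)
    then have k: "k < n" using that by auto
    have "(\<Sum>b\<in>I. G ?z a b * grad x b)
       = (\<Sum>l<n. (1 - q (rad n x)) * N x k * (N x l * N x l) + \<delta> k l * (q (rad n x) * N x l))"
      unfolding sum_I Inl
      by (simp, intro sum.cong refl) (simp add: G_Inl_N[OF U pos k] algebra_simps)
    also have "\<dots> = N x k"
      using k by (simp only: sum.distrib sum_distrib_left[symmetric] sum_N_sq[OF pos] sum_\<delta>) (simp add: algebra_simps)
    finally show ?thesis by (simp add: Inl)
  next
    case (Inr j)
    then show ?thesis using that G_mixed(2)[OF U pos, of _ j] by (auto simp: sum_I)
  qed
  have "(\<Sum>e\<in>I. christoffel I G ?z e a b * pd e F ?z) = D (rad n x) * (\<Sum>e\<in>I. christoffel I G ?z e a b * grad x e)"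
    unfolding sum_I sum_distrib_left distrib_left
    by (intro arg_cong2[where f="(+)"] sum.cong refl)
      (auto simp: pd_F_Inl[OF U pos] pd_F_Inr[OF U] N_def)
  also have "(\<Sum>e\<in>I. christoffel I G ?z e a b * grad x e) =
    (1/2) * (\<Sum>e\<in>I. grad x e * (pd a (\<lambda>y. G y e b) ?z + pd b (\<lambda>y. G y e a) ?z - pd e (\<lambda>y. G y a b) ?z))"
    by (rule christoffel_contract[where G = G and x = ?z and N = "grad x" and p = "grad x", OF finite_I pdsym grad])
  finally show ?thesis unfolding hess_loc_def by (simp add: sum_I)
qed

text \<open>The terms in \<open>1 / \<rho>\<close> and \<open>q\<close> combine with
  \<open>q'\<close> to leave \<open>w 1 \<rho> * w' 1 \<rho> / \<rho>\<^sup>2\<close>, the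
  first-factor part of the formula for Hess u.\<close>

lemma hess_Inl_Inl:
  assumes U: "(x, m) \<in> U" and pos: "0 < rad n x" and k: "k < n" and l: "l < n"
  defines "\<rho> \<equiv> rad n x"
  shows "Hs (\<phi> (x, m)) (Inl k) (Inl l) = D' \<rho> * (N x k * N x l)
    + D \<rho> * (w 1 \<rho> * w' 1 \<rho>) / \<rho>\<^sup>2 * (\<delta> k l - N x k * N x l)"
proof -
  have "Hs (\<phi> (x, m)) (Inl k) (Inl l) = D' \<rho> * (N x k * N x l) + D \<rho> * ((\<delta> k l - N x k * N x l) / \<rho>)
     - D \<rho> / 2 * ((2 * (1 - q \<rho>) / \<rho> - q' \<rho>) * (\<delta> k l - N x k * N x l))"
    using k l by (simp only: hess_pos[OF U pos] InlI lessThan_iff \<rho>_def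
        hess_F_Inl[OF U pos] christoffel_N_Inl_Inl[OF U pos])
  also have "\<dots> = D' \<rho> * (N x k * N x l)
     + D \<rho> * (1 / \<rho> - (2 * (1 - q \<rho>) / \<rho> - q' \<rho>) / 2) * (\<delta> k l - N x k * N x l)"
  proof -
    have "a + D \<rho> * (P / \<rho>) - D \<rho> / 2 * (E * P) = a + D \<rho> * (1 / \<rho> - E / 2) * P" for a P E
      by (simp add: algebra_simps)
    then show ?thesis .
  qed
  also have "1 / \<rho> - (2 * (1 - q \<rho>) / \<rho> - q' \<rho>) / 2 = w 1 \<rho> * w' 1 \<rho> / \<rho>\<^sup>2"
    by (simp add: q'_def diff_divide_distrib)
  finally show ?thesis by simp
qed

text \<open>Neither the derivatives of \<open>F\<close> nor the Cartesian block of the metric depend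
  on the points of the other factors, and the mixed block vanishes.\<close>

lemma hess_mixed:
  assumes U: "(x, m) \<in> U" and pos: "0 < rad n x" and k: "k < n" and j: "j \<in> J"
  shows "Hs (\<phi> (x, m)) (Inl k) (Inr j) = 0" "Hs (\<phi> (x, m)) (Inr j) (Inl k) = 0"
proof -
  have 1: "pd (Inl k) (pd (Inr j) F) (\<phi> (x, m)) = 0"
    using upd_Inl(1)[OF U k] j by (intro pd_Inl[OF U k]) (simp add: pd_F_Inr)
  have 2: "pd (Inr j) (pd (Inl k) F) (\<phi> (x, m)) = 0"
    using pd_F_Inl[OF _ pos k] by (intro pd_Inr_const[OF U j])
  have 3: "pd (Inl a) (\<lambda>y. G y (Inl b) (Inr j)) (\<phi> (x, m)) = 0"
       "pd (Inl a) (\<lambda>y. G y (Inr j) (Inl b)) (\<phi> (x, m)) = 0" if "a < n" "b < n" for a b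
    using that j G_mixed by (auto intro!: pd_Inl_pos[OF U that(1) pos, where Q = "\<lambda>_. 0"])
  have 4: "pd (Inr j) (\<lambda>y. G y (Inl a) (Inl k)) (\<phi> (x, m)) = 0" if "a < n" for a
    using G_Inl_Inl[OF _ pos that k] by (intro pd_Inr_const[OF U j])
  show "Hs (\<phi> (x, m)) (Inl k) (Inr j) = 0" "Hs (\<phi> (x, m)) (Inr j) (Inl k) = 0"
    using k j 1 2 3 4 by (simp_all add: hess_pos[OF U pos] InlI InrI)
qed

text \<open>Derivatives along the factors hit only mixed components, which vanish; what survives is
  the radial derivative of \<open>(w i)\<^sup>2\<close>.\<close>

lemma hess_Inr_Inr:
  assumes U: "(x, m) \<in> U" and pos: "0 < rad n x" and j: "(i, k) \<in> J" "(j, l) \<in> J"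
  defines "\<rho> \<equiv> rad n x"
  shows "Hs (\<phi> (x, m)) (Inr (i, k)) (Inr (j, l)) =
    (if i = j then D \<rho> * (w i \<rho> * w' i \<rho>) * h i (c i) (m i) k l else 0)"
proof -
  have 1: "pd (Inr (i, k)) (pd (Inr (j, l)) F) (\<phi> (x, m)) = 0"
    using pd_F_Inr j by (intro pd_Inr_const[OF U])
  have 2: "pd (Inr e) (\<lambda>y. G y (Inl a) (Inr e')) (\<phi> (x, m)) = 0" if "a < n" "e \<in> J" "e' \<in> J" for a e e'
    using G_mixed(1)[OF _ pos that(1,3)] that by (intro pd_Inr_const[OF U])
  have 3: "pd (Inl a) (\<lambda>y. G y (Inr (i, k)) (Inr (j, l))) (\<phi> (x, m)) =
     (if i = j then 2 * w i \<rho> * w' i \<rho> * h i (c i) (m i) k l else 0) * N x a" if a: "a < n" for a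
  proof (rule pd_Inl_pos[OF U a pos,
        where Q = "\<lambda>x. if i = j then (w i (rad n x))\<^sup>2 * h i (c i) (m i) k l else 0"])
    have i: "i \<in> {1..r}" using j by auto
    have "((\<lambda>\<rho>. (w i \<rho>)\<^sup>2 * h i (c i) (m i) k l) has_real_derivative
        2 * w i \<rho> * w' i \<rho> * h i (c i) (m i) k l) (at (rad n x))"
      unfolding \<rho>_def by (auto intro!: derivative_eq_intros derw[OF i pos])
    from radial_upd_deriv[OF a pos this]
    show "((\<lambda>\<tau>. if i = j then (w i (rad n (x(a := \<tau>))))\<^sup>2 * h i (c i) (m i) k l else 0) has_real_derivative
       (if i = j then 2 * w i \<rho> * w' i \<rho> * h i (c i) (m i) k l else 0) * N x a) (at (x a))"
      by (cases "i = j") (simp_all add: N_def)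
  qed (use G_Inr j in auto)
  have "Hs (\<phi> (x, m)) (Inr (i, k)) (Inr (j, l)) = - D \<rho> / 2 * (\<Sum>a<n. N x a *
      - ((if i = j then 2 * w i \<rho> * w' i \<rho> * h i (c i) (m i) k l else 0) * N x a))"
    using j 1 2 3 by (simp add: hess_pos[OF U pos] InrI \<rho>_def del: mult_minus_right)
  also have "(\<Sum>a<n. N x a * - ((if i = j then 2 * w i \<rho> * w' i \<rho> * h i (c i) (m i) k l else 0) * N x a))
      = (\<Sum>a<n. - (if i = j then 2 * w i \<rho> * w' i \<rho> * h i (c i) (m i) k l else 0) * (N x a * N x a))"
    by (intro sum.cong) auto
  also have "\<dots> = - (if i = j then 2 * w i \<rho> * w' i \<rho> * h i (c i) (m i) k l else 0)"
    by (simp only: sum_distrib_left[symmetric] sum_N_sq[OF pos] mult_1_right)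
  finally show ?thesis by auto
qed

text \<open>The form splits into a Cartesian block, with radial coefficient u'' and tangential
  coefficient of the sign of u', and blocks that are nonpositive multiples of the positive forms
  \<open>h i\<close>.\<close>

lemma hess_nonpos_pos:
  assumes U: "(x, m) \<in> U" and pos: "0 < rad n x"
  shows "(\<Sum>a\<in>I. \<Sum>b\<in>I. Hs (\<phi> (x, m)) a b * v a * v b) \<le> 0"
proof -
  define \<rho> where "\<rho> = rad n x"
  have \<rho>: "0 < \<rho>" using pos by (simp add: \<rho>_def)
  let ?z = "\<phi> (x, m)"
  define V where "V = (\<Sum>k<n. N x k * v (Inl k))"
  have "(\<Sum>a\<in>I. \<Sum>b\<in>I. Hs ?z a b * v a * v b)
    = (\<Sum>k<n. \<Sum>l<n. Hs ?z (Inl k) (Inl l) * v (Inl k) * v (Inl l))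
    + (\<Sum>p\<in>J. \<Sum>e\<in>J. Hs ?z (Inr p) (Inr e) * v (Inr p) * v (Inr e))"
    unfolding sum_I using hess_mixed[OF U pos] by (simp add: sum.distrib)
  moreover have "(\<Sum>k<n. \<Sum>l<n. Hs ?z (Inl k) (Inl l) * v (Inl k) * v (Inl l)) \<le> 0"
  proof -
    define K where "K = D \<rho> * (w 1 \<rho> * w' 1 \<rho>) / \<rho>\<^sup>2"
    have "(\<Sum>k<n. \<Sum>l<n. Hs ?z (Inl k) (Inl l) * v (Inl k) * v (Inl l))
      = (\<Sum>k<n. \<Sum>l<n. (D' \<rho> - K) * (N x k * v (Inl k)) * (N x l * v (Inl l))
          + \<delta> k l * (K * v (Inl k) * v (Inl l)))"
      by (intro sum.cong refl) (simp add: hess_Inl_Inl[OF U pos, folded \<rho>_def, folded K_def] algebra_simps)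
    also have "\<dots> = (\<Sum>k<n. (D' \<rho> - K) * (N x k * v (Inl k)) * V + K * (v (Inl k) * v (Inl k)))"
      by (intro sum.cong refl) (simp add: sum.distrib sum_distrib_left[symmetric] V_def[symmetric] sum_\<delta>)
    also have "\<dots> = (D' \<rho> - K) * V * V + K * (\<Sum>k<n. v (Inl k) * v (Inl k))"
      by (simp add: sum.distrib sum_distrib_left[symmetric] sum_distrib_right[symmetric] V_def[symmetric])
    also have "\<dots> = D' \<rho> * V\<^sup>2 + K * ((\<Sum>k<n. (v (Inl k))\<^sup>2) - V\<^sup>2)"
      by (simp add: algebra_simps power2_eq_square)
    also have "\<dots> \<le> 0"
    proof -
      \<comment> \<open>By Cauchy-Schwarz the radial component is no longer than the vector, so the
        squared tangential part is nonnegative.\<close>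
      have "V\<^sup>2 \<le> (\<Sum>k<n. (N x k)\<^sup>2) * (\<Sum>k<n. (v (Inl k))\<^sup>2)"
        unfolding V_def by (rule Cauchy_Schwarz_ineq_sum)
      then have "0 \<le> (\<Sum>k<n. (v (Inl k))\<^sup>2) - V\<^sup>2"
        using sum_N_sq[OF pos] by (simp add: power2_eq_square)
      moreover have "K \<le> 0"
        using D_nonpos[OF \<rho>] w_mono[of 1 \<rho>] \<rho> r by (simp add: K_def divide_nonpos_nonneg mult_nonpos_nonneg)
      ultimately have "K * ((\<Sum>k<n. (v (Inl k))\<^sup>2) - V\<^sup>2) \<le> 0" by (rule mult_nonpos_nonneg[rotated])
      moreover have "D' \<rho> * V\<^sup>2 \<le> 0" using D'_nonpos[OF \<rho>] by (simp add: mult_nonpos_nonneg)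
      ultimately show ?thesis by linarith
    qed
    finally show ?thesis .
  qed
  moreover have "(\<Sum>p\<in>J. \<Sum>e\<in>J. Hs ?z (Inr p) (Inr e) * v (Inr p) * v (Inr e)) \<le> 0"
  proof -
    define Q where "Q i = (\<Sum>k\<in>coords (M i). \<Sum>l\<in>coords (M i). h i (c i) (m i) k l * v (Inr (i, k)) * v (Inr (i, l)))" for i
    have fin: "finite (coords (M i))" if "i \<in> {2..r}" for i
      using mfd[OF that] by (simp add: smooth_manifold_def)
    have J: "(\<Sum>p\<in>J. A p) = (\<Sum>i=2..r. \<Sum>k\<in>coords (M i). A (i, k))" for A :: "nat \<times> nat \<Rightarrow> real"
      using sum.Sigma[of "{2..r}" "\<lambda>i. coords (M i)" "\<lambda>i k. A (i, k)"] fin by simp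
    have "(\<Sum>p\<in>J. \<Sum>e\<in>J. Hs ?z (Inr p) (Inr e) * v (Inr p) * v (Inr e))
      = (\<Sum>i=2..r. \<Sum>k\<in>coords (M i). \<Sum>j=2..r. if i = j then
           (\<Sum>l\<in>coords (M i). D \<rho> * (w i \<rho> * w' i \<rho>) * h i (c i) (m i) k l * v (Inr (i, k)) * v (Inr (i, l))) else 0)"
      unfolding J
      by (intro sum.cong refl) (auto simp: hess_Inr_Inr[OF U pos, folded \<rho>_def] intro!: sum.cong)
    also have "\<dots> = (\<Sum>i=2..r. \<Sum>k\<in>coords (M i). \<Sum>l\<in>coords (M i).
        D \<rho> * (w i \<rho> * w' i \<rho>) * h i (c i) (m i) k l * v (Inr (i, k)) * v (Inr (i, l)))"
      by (rule sum.cong[OF refl], rule sum.cong[OF refl], simp)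
    also have "\<dots> = (\<Sum>i=2..r. D \<rho> * (w i \<rho> * w' i \<rho>) * Q i)"
      unfolding Q_def sum_distrib_left by (intro sum.cong refl) (simp add: mult.assoc)
    also have "\<dots> \<le> 0"
    proof (rule sum_nonpos)
      fix i assume i: "i \<in> {2..r}"
      have "m i \<in> fst (c i)" using U i by (auto simp: U_iff)
      then have "0 \<le> Q i"
        unfolding Q_def by (intro mat_pd_nonneg riemannian_metric_pd(1)[OF metric[OF i] chart[OF i]])
      moreover have "D \<rho> * (w i \<rho> * w' i \<rho>) \<le> 0"
        using D_nonpos[OF \<rho>] w_mono[of i \<rho>] \<rho> i by (simp add: mult_nonpos_nonneg)
      ultimately show "D \<rho> * (w i \<rho> * w' i \<rho>) * Q i \<le> 0" by (rule mult_nonpos_nonneg[rotated])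
    qed
    finally show ?thesis .
  qed
  ultimately show ?thesis by linarith
qed

lemma hess_nonpos:
  assumes "p \<in> U"
  shows "(\<Sum>a\<in>I. \<Sum>b\<in>I. Hess (total_space r d M) g f (total_chart r d M c) p a b * v a * v b) \<le> 0"
proof -
  obtain x m where p: "p = (x, m)" by (cases p)
  have "(\<Sum>a\<in>I. \<Sum>b\<in>I. Hs (\<phi> (x, m)) a b * v a * v b) \<le> 0"
    using assms hess_nonpos_zero hess_nonpos_pos rad_nonneg[of n x] unfolding p
    by (cases "rad n x = 0") auto
  then show ?thesis by (simp add: Hess_def coords_total p)
qed

end

section \<open>Nonnegative Ricci curvature\<close>

theorem proposition4p18:
  fixes r :: nat and d :: "nat \<Rightarrow> nat" and lam :: "nat \<Rightarrow> real"
    and M :: "nat \<Rightarrow> ('a, nat) mfd" and h :: "nat \<Rightarrow> ('a, nat) tensor2"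
    and X Y :: "nat \<Rightarrow> real \<Rightarrow> real" and C :: real
    and t :: "real \<Rightarrow> real" and w :: "nat \<Rightarrow> real \<Rightarrow> real" and u :: "real \<Rightarrow> real"
    and g :: "((nat \<Rightarrow> real) \<times> (nat \<Rightarrow> 'a), nat + nat \<times> nat) tensor2"
    and f :: "(nat \<Rightarrow> real) \<times> (nat \<Rightarrow> 'a) \<Rightarrow> real"
  assumes "1 \<le> r" and "1 < d 1" and "lam 1 = real (d 1) - 1"
    and "\<And>i. i \<in> {2..r} \<Longrightarrow>
           smooth_manifold (M i) \<and> coords (M i) = {..<d i} \<and> 1 \<le> d i \<and> compact_space (mtop (M i)) \<and>
           riemannian_metric (M i) (h i) \<and> einstein (M i) (h i) (lam i) \<and> 0 < lam i"
    and "admissible_trajectory r d X Y"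
    and "C < 0"
    and "assoc_profile r d lam X Y C t w u"
    and "extends_warped r d M h w u g f"
    and "complete_steady_gradient_soliton (total_space r d M) g f"
  shows "nonneg_Ricci (total_space r d M) g"
proof -
  interpret P: soliton_profile r d lam X Y C t w u
  proof
    fix i assume "i \<in> {1..r}"
    then have "i = 1 \<or> i \<in> {2..r}" by auto
    then show "1 \<le> d i" "0 < lam i" using assms(2-4) by auto
  qed (use assms in auto)
  obtain D D' w' where profile: "\<forall>\<rho>>0.
      (u has_real_derivative D \<rho>) (at \<rho>) \<and> (D has_real_derivative D' \<rho>) (at \<rho>) \<and>
      D \<rho> \<le> 0 \<and> D' \<rho> \<le> 0 \<and>
      (\<forall>i\<in>{1..r}. (w i has_real_derivative w' i \<rho>) (at \<rho>) \<and> 0 \<le> w i \<rho> * w' i \<rho>)"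
    using P.radial_profile by metis
  let ?T = "total_space r d M"
  have soliton: "riemannian_metric ?T g" "smooth_fun ?T f"
    "\<And>e p k l. e \<in> atlas ?T \<Longrightarrow> p \<in> fst e \<Longrightarrow> k \<in> coords ?T \<Longrightarrow> l \<in> coords ?T \<Longrightarrow>
       Ric ?T g e p k l = - Hess ?T g f e p k l"
    using assms(9) by (auto simp: complete_steady_gradient_soliton_def eq_neg_iff_add_eq_0)
  show ?thesis
    unfolding nonneg_Ricci_def
  proof (intro ballI allI)
    fix e p and v :: "nat + nat \<times> nat \<Rightarrow> real"
    assume e: "e \<in> atlas ?T" and p: "p \<in> fst e"
    \<comment> \<open>The Euclidean factor has a single chart, so every chart of the total space
      comes from a choice of charts on the other factors.\<close>
    obtain c where c: "e = total_chart r d M c" "\<And>i. i \<in> {2..r} \<Longrightarrow> c i \<in> atlas (M i)"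
      using e by (auto simp: total_space_def prod_mfd_def euclid_def fam_prod_mfd_def total_chart_def)
    interpret W: warped_chart r d M h w w' u D D' g f c
      by unfold_locales (use assms soliton profile c in auto)
    have "(\<Sum>k\<in>coords ?T. \<Sum>l\<in>coords ?T. Ric ?T g e p k l * v k * v l)
        = - (\<Sum>k\<in>coords ?T. \<Sum>l\<in>coords ?T. Hess ?T g f e p k l * v k * v l)"
      unfolding sum_negf[symmetric] using soliton(3)[OF e p] by (intro sum.cong refl) simp
    then show "0 \<le> (\<Sum>k\<in>coords ?T. \<Sum>l\<in>coords ?T. Ric ?T g e p k l * v k * v l)"
      using W.hess_nonpos[of p v] p by (simp add: c(1) W.coords_total)
  qed
qed

end
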